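(* Let $d\ge1$ be an integer. The prevalent $f\in\mathrm{Homeo}([0,1]^d)$ is singular; that is, the set of singular $f\in\mathrm{Homeo}([0,1]^d)$ is prevalent in $\mathrm{Homeo}([0,1]^d)$.
   Context: $\mathrm{Homeo}([0,1]^d)$ is the group (under composition) of homeomorphisms of $[0,1]^d$ with the topology of the maximum metric $\max_x|f(x)-g(x)|$; it is a Polish group. A subset $X$ of a Polish group $G$ is Haar null if there exist a Borel probability measure $\mu$ on $G$ and a Borel set $B\supseteq X$ such that $\mu(gBh)=0$ for all $g,h\in G$; the complement of a Haar null set is called prevalent. $\lambda^d$ denotes $d$-dimensional Lebesgue measure. A homeomorphism $f\in\mathrm{Homeo}([0,1]^d)$ is singular if there exists a Borel set $F\subseteq[0,1]^d$ with $\lambda^d(F)=1$ and $\lambda^d(f(F))=0$. *)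

theory Defs
  imports "HOL-Analysis.Analysis" "HOL-Probability.Probability_Measure" "HOL-Algebra.Bij" "HOL-Algebra.Coset"
begin

section \<open>Haar null and prevalent subsets of a topological group\<close>

definition borel_sigma :: "'a topology \<Rightarrow> 'a measure" where
  "borel_sigma X = sigma (topspace X) {U. openin X U}"

text \<open>
  \<open>G\<close> is a group whose carrier is the underlying set of the topology \<open>X\<close>.
  In a topological group all two-sided translates \<open>gBh\<close> of a Borel set are Borel, so membership
  in \<open>null_sets \<mu>\<close> says exactly \<open>\<mu>(gBh) = 0\<close>; the formulation excludes the junk value that
  \<open>emeasure\<close> takes on non-measurable sets.
\<close>

definition haar_null :: "('a, 'b) monoid_scheme \<Rightarrow> 'a topology \<Rightarrow> 'a set \<Rightarrow> bool" where
  "haar_null G X A \<longleftrightarrow> A \<subseteq> carrier G \<and>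
     (\<exists>\<mu> B. prob_space \<mu> \<and> sets \<mu> = sets (borel_sigma X) \<and>
        B \<in> sets (borel_sigma X) \<and> A \<subseteq> B \<and>
        (\<forall>g\<in>carrier G. \<forall>h\<in>carrier G. (g <#\<^bsub>G\<^esub> B) #>\<^bsub>G\<^esub> h \<in> null_sets \<mu>))"

definition prevalent :: "('a, 'b) monoid_scheme \<Rightarrow> 'a topology \<Rightarrow> 'a set \<Rightarrow> bool" where
  "prevalent G X A \<longleftrightarrow> A \<subseteq> carrier G \<and> haar_null G X (carrier G - A)"


section \<open>The homeomorphism group of a space with the maximum metric\<close>

text \<open>
  Elements are extensional functions (as in \<open>BijGroup\<close>), so that each homeomorphism of \<open>S\<close>
  is represented by exactly one HOL function.
\<close>

definition Homeo :: "'a::topological_space set \<Rightarrow> ('a \<Rightarrow> 'a) set" where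
  "Homeo S = {f \<in> extensional S. \<exists>f'. homeomorphism S S f f'}"

definition homeo_group :: "'a::topological_space set \<Rightarrow> ('a \<Rightarrow> 'a) monoid" where
  "homeo_group S = (BijGroup S)\<lparr>carrier := Homeo S\<rparr>"

text \<open>
  The supremum is a maximum when \<open>S\<close> is compact and nonempty (see \<open>homeo_dist_attained\<close>).
  The value outside \<open>Homeo S\<close> is irrelevant; it is set to 0 because the locale \<open>Metric_space\<close>
  demands nonnegativity and symmetry also off the carrier.
\<close>

definition homeo_dist :: "'a::metric_space set \<Rightarrow> ('a \<Rightarrow> 'a) \<Rightarrow> ('a \<Rightarrow> 'a) \<Rightarrow> real" where
  "homeo_dist S f g =
     (if f \<in> Homeo S \<and> g \<in> Homeo S then (SUP x\<in>S. dist (f x) (g x)) else 0)"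

definition homeo_topology :: "'a::metric_space set \<Rightarrow> ('a \<Rightarrow> 'a) topology" where
  "homeo_topology S = Metric_space.mtopology (Homeo S) (homeo_dist S)"

lemma carrier_homeo_group [simp]: "carrier (homeo_group S) = Homeo S"
  by (simp add: homeo_group_def)

lemma Homeo_subset_Bij: "Homeo S \<subseteq> Bij S"
  by (auto simp: Homeo_def Bij_def homeomorphism_def bij_betw_def intro: inj_on_inverseI)

lemma mult_homeo_group:
  assumes "f \<in> Homeo S" "g \<in> Homeo S"
  shows "f \<otimes>\<^bsub>homeo_group S\<^esub> g = compose S f g"
  using assms Homeo_subset_Bij by (auto simp: homeo_group_def BijGroup_def)

lemma group_homeo_group: "group (homeo_group S)"
proof -
  interpret B: group "BijGroup S" by (rule group_BijGroup)
  have "subgroup (Homeo S) (BijGroup S)"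
  proof (rule B.subgroupI)
    show "Homeo S \<subseteq> carrier (BijGroup S)"
      using Homeo_subset_Bij by (simp add: BijGroup_def)
    have "(\<lambda>x\<in>S. x) \<in> Homeo S"
      unfolding Homeo_def
      by (auto intro!: exI[of _ "\<lambda>x. x"] homeomorphism_cong[OF homeomorphism_ident])
    then show "Homeo S \<noteq> {}" by blast
  next
    fix f assume f: "f \<in> Homeo S"
    then obtain f' where f': "homeomorphism S S f f'" by (auto simp: Homeo_def)
    let ?i = "\<lambda>x\<in>S. f' x"
    have i: "?i \<in> Homeo S"
      unfolding Homeo_def using homeomorphism_symD[OF f']
      by (auto intro!: exI[of _ f] homeomorphism_cong[OF homeomorphism_symD[OF f']])
    have "?i \<otimes>\<^bsub>BijGroup S\<^esub> f = \<one>\<^bsub>BijGroup S\<^esub>"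
      using i f f' Homeo_subset_Bij
      by (auto simp: BijGroup_def compose_def restrict_def homeomorphism_def fun_eq_iff)
    with i f Homeo_subset_Bij have "inv\<^bsub>BijGroup S\<^esub> f = ?i"
      by (intro B.inv_equality) (auto simp: BijGroup_def)
    with i show "inv\<^bsub>BijGroup S\<^esub> f \<in> Homeo S" by simp
  next
    fix f g assume fg: "f \<in> Homeo S" "g \<in> Homeo S"
    then obtain f' g' where h: "homeomorphism S S f f'" "homeomorphism S S g g'"
      by (auto simp: Homeo_def)
    have "homeomorphism S S (compose S f g) (g' \<circ> f')"
      by (rule homeomorphism_cong[OF homeomorphism_compose[OF h(2,1)]]) (auto simp: compose_def)
    then have "compose S f g \<in> Homeo S" by (auto simp: Homeo_def)
    then show "f \<otimes>\<^bsub>BijGroup S\<^esub> g \<in> Homeo S"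
      using fg Homeo_subset_Bij by (auto simp: BijGroup_def)
  qed
  then show ?thesis
    unfolding homeo_group_def by (rule B.subgroup_imp_group)
qed

lemma homeo_dist_attained:
  assumes "compact S" "S \<noteq> {}" "f \<in> Homeo S" "g \<in> Homeo S"
  shows "\<exists>x\<in>S. homeo_dist S f g = dist (f x) (g x) \<and> (\<forall>y\<in>S. dist (f y) (g y) \<le> dist (f x) (g x))"
proof -
  have "continuous_on S (\<lambda>x. dist (f x) (g x))"
    using assms(3,4) by (auto simp: Homeo_def homeomorphism_def intro!: continuous_intros)
  then obtain x where x: "x \<in> S" "\<forall>y\<in>S. dist (f y) (g y) \<le> dist (f x) (g x)"
    using continuous_attains_sup[OF assms(1,2)] by blast
  then have "(SUP x\<in>S. dist (f x) (g x)) = dist (f x) (g x)"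
    by (intro cSup_eq_maximum) auto
  with x assms show ?thesis by (auto simp: homeo_dist_def)
qed

lemma Metric_space_homeo:
  assumes "compact S" "S \<noteq> {}"
  shows "Metric_space (Homeo S) (homeo_dist S)"
proof
  note att = homeo_dist_attained[OF assms]
  fix f g :: "'a \<Rightarrow> 'a"
  show "0 \<le> homeo_dist S f g"
    using att[of f g] by (cases "f \<in> Homeo S \<and> g \<in> Homeo S") (auto simp: homeo_dist_def)
  show "homeo_dist S f g = homeo_dist S g f"
    by (simp add: homeo_dist_def dist_commute conj_commute)
  assume f: "f \<in> Homeo S" and g: "g \<in> Homeo S"
  show "homeo_dist S f g = 0 \<longleftrightarrow> f = g"
  proof
    assume "homeo_dist S f g = 0"
    with att[OF f g] have "\<forall>y\<in>S. f y = g y" by fastforce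
    then show "f = g" using f g by (auto simp: Homeo_def intro: extensionalityI)
  next
    assume "f = g" with att[OF f g] show "homeo_dist S f g = 0" by auto
  qed
  fix h assume h: "h \<in> Homeo S"
  obtain x where x: "x \<in> S" "homeo_dist S f h = dist (f x) (h x)" using att[OF f h] by blast
  have "dist (f x) (g x) \<le> homeo_dist S f g" "dist (g x) (h x) \<le> homeo_dist S g h"
    using att[OF f g] att[OF g h] x by auto
  with x show "homeo_dist S f h \<le> homeo_dist S f g + homeo_dist S g h"
    using dist_triangle[of "f x" "h x" "g x"] by linarith
qed


section \<open>Singular homeomorphisms of the unit cube\<close>

text \<open>The dimension is \<open>CARD('n)\<close>; here \<open>1\<close> is the vector all of whose coordinates are 1.\<close>

abbreviation unit_cube :: "(real ^ 'n) set" where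
  "unit_cube \<equiv> cbox 0 1"

lemma mem_unit_cube: "x \<in> unit_cube \<longleftrightarrow> (\<forall>i. 0 \<le> x $ i \<and> x $ i \<le> 1)"
  by (simp add: mem_box_cart)

definition singular_homeo :: "(real ^ 'n \<Rightarrow> real ^ 'n) \<Rightarrow> bool" where
  "singular_homeo f \<longleftrightarrow> f \<in> Homeo unit_cube \<and>
     (\<exists>F\<in>sets borel. F \<subseteq> unit_cube \<and> emeasure lborel F = 1 \<and> f ` F \<in> null_sets lborel)"

end

theory Submission
  imports Defs "HOL-Probability.Distributions" "HOL-Probability.Distribution_Functions"
begin

text \<open>
  Fix one singular homeomorphism \<open>s\<close> of the cube and let \<open>\<Phi>(t,u) = flow t \<circ> s \<circ> flow (-u)\<close> with
  \<open>(t,u)\<close> uniformly distributed, where \<open>flow\<close> is a smooth action of \<open>\<real>\<^sup>n\<close> on the cube that is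
  simply transitive on the interior. Then \<open>\<Phi>\<close> is always singular, and for interior points \<open>x\<close>
  and \<open>y\<close> the random points \<open>\<Phi>(x)\<close> and \<open>\<Phi>\<^sup>-\<^sup>1(y)\<close> have distributions absolutely continuous
  with respect to \<open>\<lambda>\<close>.

  Given \<open>g\<close> and \<open>h\<close>, singularity of \<open>g \<circ> \<Phi> \<circ> h\<close> means that \<open>\<Phi>\<close> carries \<open>\<nu> = h\<^sub>*\<lambda>\<close> to a
  measure singular to \<open>\<eta> = (g\<^sup>-\<^sup>1)\<^sub>*\<lambda>\<close>. Let \<open>N\<^sub>1\<close> and \<open>N\<^sub>2\<close> be Lebesgue null sets carrying the singular
  parts of \<open>\<nu>\<close> and \<open>\<eta>\<close>. By Fubini, almost surely \<open>\<nu>(\<Phi>\<^sup>-\<^sup>1(N\<^sub>2)) = 0\<close> and \<open>\<eta>(\<Phi>(N\<^sub>1)) = 0\<close>, which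
  takes care of the singular parts; for the absolutely continuous parts singularity of \<open>\<Phi>\<close> suffices.
  By invariance of domain, \<open>g\<close> and \<open>h\<close> preserve the interior, so boundary points do not matter.
\<close>

section \<open>A singular homeomorphism of the unit interval\<close>

text \<open>
  \<open>spread\<close> reads the binary digits of the fractional part in base 4, so its range is a null set.
\<close>

definition bit2 :: "real \<Rightarrow> real" where
  "bit2 u = of_int (\<lfloor>2 * u\<rfloor> mod 2)"

definition spread :: "real \<Rightarrow> real" where
  "spread u = (\<Sum>i. bit2 (2 ^ i * u) / 4 ^ Suc i)"

lemma bit2_cases: "bit2 u = 0 \<or> bit2 u = 1"
  unfolding bit2_def by (simp, presburger)

lemma bit2_bounds: "0 \<le> bit2 u" "bit2 u \<le> 1"
  using bit2_cases[of u] by auto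

lemma summable_quarter: "summable (\<lambda>i. 1 / (4::real) ^ Suc i)"
  using summable_mult[OF summable_geometric[of "1/4::real"], of "1/4"]
  by (simp add: power_divide)

lemma summable_spread: "summable (\<lambda>i. bit2 (2 ^ i * u) / 4 ^ Suc i)"
  by (rule summable_comparison_test'[OF summable_quarter, of 0])
     (use bit2_bounds in \<open>auto simp: divide_simps\<close>)

text \<open>Doubling \<open>u\<close> drops its first binary digit, so the range is covered by two
  quarter-size copies of itself.\<close>

lemma spread_rec: "spread u = (bit2 u + spread (2 * u)) / 4"
proof -
  have "spread (2 * u) / 4 = (\<Sum>i. bit2 (2 ^ Suc i * u) / 4 ^ Suc (Suc i))"
    unfolding spread_def
    using suminf_divide[OF summable_spread[of "2 * u"], of 4] by (simp add: mult_ac)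
  also have "\<dots> = spread u - bit2 u / 4"
    unfolding spread_def using suminf_split_head[OF summable_spread[of u]] by simp
  finally show ?thesis by (simp add: field_simps)
qed

lemma spread_bounds: "0 \<le> spread u" "spread u \<le> 1 / 3"
proof -
  show "0 \<le> spread u"
    unfolding spread_def by (intro suminf_nonneg summable_spread) (simp add: bit2_bounds)
  have "spread u \<le> (\<Sum>i. 1 / (4::real) ^ Suc i)"
    unfolding spread_def
    by (intro suminf_le summable_spread summable_quarter) (simp add: bit2_bounds divide_simps)
  also have "\<dots> = (\<Sum>i. (1/4) * (1/4::real) ^ i)" by (simp add: power_divide)
  also have "\<dots> = 1 / 3"
    by (subst suminf_mult) (simp_all add: suminf_geometric)
  finally show "spread u \<le> 1 / 3" .
qed

lemma borel_measurable_spread [measurable]: "spread \<in> borel_measurable borel"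
  unfolding spread_def[abs_def] bit2_def by measurable

text \<open>The first \<open>n\<close> binary digits of the fractional part vanish, so the base 4
  expansion starts with \<open>n\<close> zeros.\<close>

lemma spread_small:
  assumes "of_int k \<le> u" "u < of_int k + 1 / 2 ^ n"
  shows "spread u \<le> 1 / 4 ^ n"
  using assms
proof (induction n arbitrary: k u)
  case 0
  then show ?case using spread_bounds[of u] by simp
next
  case (Suc n)
  have "2 * u < of_int (2 * k) + 1 / 2 ^ n" using Suc.prems(2) by (simp add: field_simps)
  then have "spread (2 * u) \<le> 1 / 4 ^ n" using Suc.prems(1) by (intro Suc.IH[of "2 * k"]) auto
  moreover have "\<lfloor>2 * u\<rfloor> = 2 * k"
  proof (rule floor_unique)
    have "1 / (2::real) ^ n \<le> 1" by simp
    then show "2 * u < of_int (2 * k) + 1"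
      using \<open>2 * u < _\<close> by linarith
  qed (use Suc.prems(1) in simp)
  then have "bit2 u = 0" by (simp add: bit2_def)
  ultimately show ?case by (subst spread_rec) simp
qed

text \<open>By \<open>spread_bounds\<close> the tail contributes at most 1/3, too little to
  compensate for a change of the leading digit by 1.\<close>

lemma spread_eq_double:
  assumes "spread u = spread v"
  shows "bit2 u = bit2 v" "spread (2 * u) = spread (2 * v)"
proof -
  have *: "bit2 u + spread (2 * u) = bit2 v + spread (2 * v)"
    using assms spread_rec[of u] spread_rec[of v] by simp
  show "bit2 u = bit2 v"
    using * spread_bounds[of "2 * u"] spread_bounds[of "2 * v"] bit2_cases[of u] bit2_cases[of v] by auto
  with * show "spread (2 * u) = spread (2 * v)" by simp
qed

text \<open>Equal digits and equal integer parts give \<open>2 ^ n * u\<close> and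
  \<open>2 ^ n * v\<close> the same integer part for every \<open>n\<close>. So they always differ
  by less than 1, although any gap between \<open>u\<close> and \<open>v\<close> would be magnified
  without bound.\<close>

lemma spread_floor_inj:
  assumes eq: "spread u = spread v" and fl: "\<lfloor>u\<rfloor> = \<lfloor>v\<rfloor>"
  shows "u = v"
proof (rule ccontr)
  assume "u \<noteq> v"
  have *: "spread (2 ^ n * u) = spread (2 ^ n * v) \<and> \<lfloor>2 ^ n * u\<rfloor> = \<lfloor>2 ^ n * v\<rfloor>" for n
  proof (induction n)
    case 0
    then show ?case using assms by simp
  next
    case (Suc n)
    \<comment> \<open>The next integer part is determined by the current one and the next binary
      digit.\<close>
    have fl2: "\<lfloor>2 * x\<rfloor> = 2 * \<lfloor>x\<rfloor> + \<lfloor>2 * x\<rfloor> mod 2" for x :: real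
    proof -
      have "\<lfloor>2 * x\<rfloor> div 2 = \<lfloor>x\<rfloor>"
        using floor_divide_real_eq_div[of 2 "2 * x"] by simp
      then show ?thesis by (metis mult_div_mod_eq)
    qed
    from Suc spread_eq_double[of "2 ^ n * u" "2 ^ n * v"]
    show ?case using fl2[of "2 ^ n * u"] fl2[of "2 ^ n * v"] by (simp add: bit2_def mult.assoc)
  qed
  have **: "\<bar>2 ^ n * u - 2 ^ n * v\<bar> < 1" for n
    using floor_correct[of "2 ^ n * u"] floor_correct[of "2 ^ n * v"] *[of n] by linarith
  obtain n where "1 / \<bar>u - v\<bar> < 2 ^ n" using real_arch_pow[of 2] by auto
  then have "1 < 2 ^ n * \<bar>u - v\<bar>" using \<open>u \<noteq> v\<close> by (simp add: field_simps)
  then show False using **[of n] by (simp add: abs_mult flip: right_diff_distrib)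
qed

text \<open>The closure is compact, hence measurable of finite measure \<open>m\<close>. It is
  covered by two copies of itself scaled by 1/4, so \<open>m <= m / 2\<close>.\<close>

lemma null_closure_range_spread: "closure (range spread) \<in> null_sets lborel"
proof -
  let ?R = "closure (range spread)"
  let ?f = "\<lambda>b x. (1/4) *\<^sub>R x + b :: real"
  have "bounded (range spread)"
    using spread_bounds by (intro boundedI[of _ "1/3"]) auto
  then have cpt: "compact ?R" by (simp add: compact_closure)
  have sub: "?R \<subseteq> ?f 0 ` ?R \<union> ?f (1/4) ` ?R"
  proof (rule closure_minimal)
    show "closed (?f 0 ` ?R \<union> ?f (1/4) ` ?R)"
      by (intro closed_Un compact_imp_closed compact_continuous_image cpt continuous_intros)
    show "range spread \<subseteq> ?f 0 ` ?R \<union> ?f (1/4) ` ?R"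
    proof clarify
      fix u assume "spread u \<notin> ?f (1/4) ` ?R"
      moreover have "spread (2 * u) \<in> ?R" by (rule subsetD[OF closure_subset rangeI])
      moreover have "spread u = ?f (bit2 u / 4) (spread (2 * u))"
        by (subst spread_rec) simp
      ultimately show "spread u \<in> ?f 0 ` ?R" using bit2_cases[of u] by auto
    qed
  qed
  have m: "measure lebesgue (?f b ` ?R) = measure lebesgue ?R / 4" for b
    using measure_lebesgue_affine[of "1/4" b ?R] by simp
  have lm: "?R \<in> lmeasurable" "?f b ` ?R \<in> lmeasurable" for b
    by (intro lmeasurable_compact compact_continuous_image cpt continuous_intros)+
  have "measure lebesgue ?R \<le> measure lebesgue (?f 0 ` ?R) + measure lebesgue (?f (1/4) ` ?R)"
    using measure_mono_fmeasurable[OF sub] lm measure_Un_le[of "?f 0 ` ?R" lebesgue "?f (1/4) ` ?R"]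
    by (meson fmeasurable.Un fmeasurableD order_trans)
  then have "measure lebesgue ?R \<le> 0" unfolding m by simp
  then have "measure lebesgue ?R = 0" by (simp add: measure_le_0_iff)
  then have "?R \<in> null_sets lebesgue"
    using lm(1) by (simp add: null_sets_def emeasure_eq_measure2 fmeasurableD)
  then show ?thesis by (simp add: null_sets_completion_iff)
qed

section \<open>Singular nonatomic distributions of full support\<close>

text \<open>
  A translated copy of \<open>spread\<close> on each interval \<open>[k, k+1)\<close>, with the translations dense: the range
  stays null, while the image of a measure with positive density is nonatomic with full support.
\<close>

definition scatter :: "real \<Rightarrow> real" where
  "scatter u = from_nat_into \<rat> (nat \<lfloor>u\<rfloor>) + spread u"

lemma borel_measurable_scatter [measurable]: "scatter \<in> borel_measurable borel"
proof -
  have "(\<lambda>u::real. nat \<lfloor>u\<rfloor>) \<in> borel \<rightarrow>\<^sub>M count_space UNIV" by measurable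
  then have "(\<lambda>u::real. from_nat_into \<rat> (nat \<lfloor>u\<rfloor>) :: real) \<in> borel_measurable borel"
    by (rule measurable_compose) simp
  then show ?thesis unfolding scatter_def[abs_def] by (intro borel_measurable_add) auto
qed

text \<open>For a fixed integer part \<open>scatter\<close> is a translate of an injective piece of
  \<open>spread\<close>, so a fiber has at most one point per integer. This excludes atoms
  later.\<close>

lemma countable_scatter_fiber: "countable {u. scatter u = x}"
proof (rule countable_image_inj_on)
  show "inj_on floor {u. scatter u = x}"
  proof (rule inj_onI)
    fix u v :: real assume "u \<in> {u. scatter u = x}" "v \<in> {u. scatter u = x}" and fl: "\<lfloor>u\<rfloor> = \<lfloor>v\<rfloor>"
    then have "scatter u = scatter v" by simp
    then have "spread u = spread v" unfolding scatter_def fl by simp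
    then show "u = v" using fl by (rule spread_floor_inj)
  qed
qed simp

lemma scatter_range_null:
  obtains A where "A \<in> null_sets lborel" "range scatter \<subseteq> A"
proof
  let ?A = "\<Union>q\<in>\<rat>. {x. x - q \<in> closure (range spread)}"
  show "?A \<in> null_sets lborel"
  proof (rule null_sets_UN')
    show "countable (\<rat> :: real set)" by (rule countable_rat)
    fix q :: real
    show "{x. x - q \<in> closure (range spread)} \<in> null_sets lborel"
      using null_closure_range_spread by (rule null_sets_translation)
  qed
  have "from_nat_into \<rat> n \<in> (\<rat> :: real set)" for n
    by (rule from_nat_into) auto
  moreover have "spread u \<in> closure (range spread)" for u
    by (rule subsetD[OF closure_subset rangeI])
  ultimately have "scatter u \<in> {x. x - from_nat_into \<rat> (nat \<lfloor>u\<rfloor>) \<in> closure (range spread)}"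
    "from_nat_into \<rat> (nat \<lfloor>u\<rfloor>) \<in> (\<rat> :: real set)" for u
    by (simp_all add: scatter_def)
  then show "range scatter \<subseteq> ?A" by (intro image_subsetI UN_I)
qed

text \<open>Let \<open>k\<close> be the index of a rational \<open>q\<close> in the target interval.
  Just to the right of \<open>k\<close>, the value of \<open>scatter\<close> exceeds
  \<open>q\<close> by at most \<open>1 / 4 ^ n\<close>.\<close>

lemma scatter_hits_open_intervals:
  assumes "a < b"
  obtains c d where "c < d" "\<And>u. u \<in> {c<..<d} \<Longrightarrow> scatter u \<in> {a<..<b}"
proof -
  obtain q where q: "q \<in> \<rat>" "a < q" "q < b" using Rats_dense_in_real[OF assms] by blast
  then obtain k where k: "from_nat_into \<rat> k = q"
    using range_from_nat_into[OF _ countable_rat] by (metis rangeE empty_iff)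
  obtain n where n: "(1 / 4) ^ n < b - q"
    using real_arch_pow_inv[of "b - q" "1/4"] q by auto
  show thesis
  proof
    show "real k < real k + 1 / 2 ^ n" by simp
    fix u assume u: "u \<in> {real k<..<real k + 1 / 2 ^ n}"
    have "1 / (2::real) ^ n \<le> 1" by simp
    then have "u < real k + 1" using u by (simp only: greaterThanLessThan_iff) linarith
    then have "\<lfloor>u\<rfloor> = int k" using u by (intro floor_unique) auto
    moreover have "spread u \<le> 1 / 4 ^ n" using u by (intro spread_small[of "int k"]) auto
    ultimately show "scatter u \<in> {a<..<b}"
      using q n spread_bounds(1)[of u] by (simp add: scatter_def k power_divide)
  qed
qed

text \<open>The witness is the law of \<open>scatter\<close> under a standard normal variable. The
  normal density is positive everywhere, so it gives the same null sets as Lebesgue measure.\<close>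

lemma singular_distribution_exists:
  obtains M A where "real_distribution M" "\<And>x. measure M {x} = 0"
    "\<And>a b. a < b \<Longrightarrow> 0 < measure M {a<..<b}" "A \<in> null_sets lborel" "AE x in M. x \<in> A"
proof -
  let ?N = "density lborel std_normal_density"
  interpret N: prob_space ?N by (rule prob_space_normal_density) simp
  have null: "X \<in> null_sets ?N \<longleftrightarrow> X \<in> null_sets lborel" for X
  proof -
    have "normal_density 0 1 x \<noteq> 0" for x :: real
      using normal_density_pos[of 1 0 x] by simp
    then show ?thesis
      by (subst null_sets_density_iff) (auto simp: AE_iff_null_sets[of X] AE_not_in)
  qed
  obtain A where A: "A \<in> null_sets lborel" "range scatter \<subseteq> A" by (rule scatter_range_null)
  have sc [measurable]: "scatter \<in> borel_measurable ?N" by simp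
  show thesis
  proof
    show "real_distribution (distr ?N borel scatter)" by simp
    fix x
    have "{u. scatter u = x} \<in> null_sets ?N"
      unfolding null by (intro countable_imp_null_set_lborel countable_scatter_fiber)
    then show "measure (distr ?N borel scatter) {x} = 0"
      by (simp add: measure_distr vimage_def measure_eq_0_null_sets)
  next
    fix a b :: real assume "a < b"
    then obtain c d where cd: "c < d" "\<And>u. u \<in> {c<..<d} \<Longrightarrow> scatter u \<in> {a<..<b}"
      by (rule scatter_hits_open_intervals) blast
    have "emeasure ?N {c<..<d} \<noteq> 0"
      using null[of "{c<..<d}"] cd(1) by (auto simp: null_sets_def)
    then have "0 < measure ?N {c<..<d}"
      by (simp add: N.emeasure_eq_measure zero_less_measure_iff)
    also have "\<dots> \<le> measure ?N (scatter -` {a<..<b} \<inter> space ?N)"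
      using cd(2) measurable_sets[OF sc, of "{a<..<b}"] by (intro N.finite_measure_mono) auto
    also have "\<dots> = measure (distr ?N borel scatter) {a<..<b}"
      by (simp add: measure_distr)
    finally show "0 < measure (distr ?N borel scatter) {a<..<b}" .
  next
    show "A \<in> null_sets lborel" by (rule A)
    then have "{x \<in> space borel. x \<in> A} \<in> sets borel" by auto
    then show "AE x in distr ?N borel scatter. x \<in> A"
      using A(2) by (subst AE_distr_iff) auto
  qed
qed

section \<open>From distribution functions to homeomorphisms\<close>

text \<open>Absence of atoms makes the distribution function continuous, and positive mass of
  intervals makes it strictly increasing. Its inverse is the quantile function, which carries the
  uniform distribution to \<open>M\<close>.\<close>

lemma homeomorphism_cdf:
  assumes M: "real_distribution M" and I: "measure M {0..1} = 1"
    and atom: "\<And>x. measure M {x} = 0"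
    and pos: "\<And>a b. 0 \<le> a \<Longrightarrow> a < b \<Longrightarrow> b \<le> 1 \<Longrightarrow> 0 < measure M {a<..<b}"
  obtains s' where "homeomorphism {0..1} {0..1} (cdf M) s'"
    "\<forall>A \<in> null_sets M. {y \<in> {0..1}. s' y \<in> A} \<in> null_sets lborel"
proof -
  interpret M: real_distribution M by fact
  have [simp]: "M.random_variable borel (\<lambda>x. x)" by simp
  have out: "measure M X = 0" if "X \<inter> {0..1} = {}" "X \<in> sets borel" for X
  proof -
    have "measure M (X \<union> {0..1}) = measure M X + 1"
      using that by (subst M.finite_measure_Union) (auto simp: I)
    then show ?thesis using M.prob_le_1[of "X \<union> {0..1}"] measure_nonneg[of M X] by linarith
  qed
  have c0: "cdf M 0 = 0"
  proof -
    have "measure M ({..<0} \<union> {0}) = 0"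
      using out[of "{..<0}"] by (subst M.finite_measure_Union) (force simp: atom)+
    moreover have "{..<0} \<union> {0} = {..0::real}" by auto
    ultimately show ?thesis by (simp add: cdf_def)
  qed
  have c1: "cdf M 1 = 1"
  proof -
    have "measure M {0..1} \<le> measure M {..1}" by (intro M.finite_measure_mono) auto
    then show ?thesis using I M.prob_le_1[of "{..1}"] by (simp add: cdf_def)
  qed
  have cont: "continuous_on X (cdf M)" for X
    using M.isCont_cdf atom by (auto intro: continuous_at_imp_continuous_on)
  have mono: "strict_mono_on {0..1} (cdf M)"
  proof (rule strict_mono_onI)
    fix a b :: real assume ab: "a \<in> {0..1}" "b \<in> {0..1}" "a < b"
    then have "0 < measure M {a<..<b}" by (intro pos) auto
    also have "\<dots> \<le> measure M {a<..b}" by (intro M.finite_measure_mono) auto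
    also have "\<dots> = cdf M b - cdf M a" using M.cdf_diff_eq[OF ab(3)] by simp
    finally show "cdf M a < cdf M b" by simp
  qed
  have img: "cdf M ` {0..1} = {0..1}"
  proof
    show "cdf M ` {0..1} \<subseteq> {0..1}"
      using M.cdf_nondecreasing[of 0] M.cdf_nondecreasing[of _ 1] by (auto simp: c0 c1)
    show "{0..1} \<subseteq> cdf M ` {0..1}"
    proof
      fix y :: real assume "y \<in> {0..1}"
      then have "\<exists>x\<ge>0. x \<le> 1 \<and> cdf M x = y" by (intro IVT') (auto simp: c0 c1 cont)
      then show "y \<in> cdf M ` {0..1}" by auto
    qed
  qed
  then obtain s' where s': "homeomorphism {0..1} {0..1} (cdf M) s'"
    using homeomorphism_compact[OF _ cont img strict_mono_on_imp_inj_on[OF mono]] by auto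
  have s'_in: "s' y \<in> {0..1}" "cdf M (s' y) = y" if "y \<in> {0..1}" for y
    using s' that by (auto simp: homeomorphism_def)
  \<comment> \<open>The quantile function is extended by the constant 0 to a total Borel function;
    the uniform measure does not see the extension.\<close>
  define r where "r y = (if y \<in> {0..1} then s' y else 0)" for y
  have r [measurable]: "r \<in> borel_measurable borel"
    using homeomorphism_cont2[OF s'] unfolding r_def[abs_def]
    by (intro borel_measurable_continuous_on_if) auto
  let ?U = "uniform_measure lborel {0..1::real}"
  interpret U: prob_space ?U by (rule prob_space_uniform_measure) auto
  have "distr ?U borel r = M"
  proof (rule cdf_unique)
    show "real_distribution (distr ?U borel r)" by simp
    show "cdf (distr ?U borel r) = cdf M"
    proof
      fix x
      have *: "cdf (distr ?U borel r) x = measure lborel ({0..1} \<inter> r -` {..x})"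
        unfolding cdf_def using measurable_sets[OF r, of "{..x}"]
        by (subst measure_distr) (auto simp: measure_uniform_measure)
      consider "x < 0" | "x \<in> {0..1}" | "1 < x" by fastforce
      then show "cdf (distr ?U borel r) x = cdf M x"
      proof cases
        case 1
        then have "{0..1} \<inter> r -` {..x} = {}" using s'_in by (fastforce simp: r_def)
        moreover have "cdf M x = 0" using M.cdf_nondecreasing[of x 0] M.cdf_nonneg[of x] c0 1 by simp
        ultimately show ?thesis by (simp add: *)
      next
        case 2
        have "s' y \<le> x \<longleftrightarrow> y \<le> cdf M x" if "y \<in> {0..1}" for y
          using strict_mono_on_less_eq[OF mono, of "s' y" x] s'_in[OF that] 2 by simp
        moreover have "cdf M x \<in> {0..1}" using img 2 by blast
        ultimately have "{0..1} \<inter> r -` {..x} = {0..cdf M x}" by (auto simp: r_def)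
        then show ?thesis using \<open>cdf M x \<in> {0..1}\<close> by (simp add: *)
      next
        case 3
        then have "{0..1} \<inter> r -` {..x} = {0..1}" using s'_in by (fastforce simp: r_def)
        moreover have "cdf M x = 1" using M.cdf_nondecreasing[of 1 x] M.cdf_bounded_prob[of x] c1 3 by simp
        ultimately show ?thesis by (simp add: *)
      qed
    qed
  qed (rule M)
  then have r_null: "r -` A \<inter> space ?U \<in> null_sets ?U" if "A \<in> null_sets M" for A
    using that null_sets_distr_iff[of r ?U borel A] by simp
  then have "{y \<in> {0..1}. s' y \<in> A} \<in> null_sets lborel" if A: "A \<in> null_sets M" for A
  proof -
    have "emeasure ?U (r -` A) = 0" "r -` A \<in> sets borel"
      using r_null[OF A] by (auto simp: null_sets_def)
    then have "emeasure lborel ({0..1} \<inter> r -` A) = 0" by (simp add: emeasure_uniform_measure)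
    moreover have "{y \<in> {0..1}. s' y \<in> A} = {0..1} \<inter> r -` A" by (auto simp: r_def)
    ultimately show ?thesis using \<open>r -` A \<in> sets borel\<close> by (simp add: null_sets_def)
  qed
  with that[OF s'] show thesis by blast
qed

text \<open>The homeomorphism is the distribution function of the singular distribution conditioned
  on the unit interval. The last conclusion says that \<open>s\<close> sends the complement of the
  null set \<open>A\<close> to a null set.\<close>

lemma singular_homeomorphism_interval:
  obtains s s' :: "real \<Rightarrow> real" and A where
    "homeomorphism {0..1} {0..1} s s'"
    "A \<in> null_sets lborel" "{y \<in> {0..1}. s' y \<notin> A} \<in> null_sets lborel"
proof -
  obtain M A where M: "real_distribution M" "\<And>x. measure M {x} = 0"
    "\<And>a b. a < b \<Longrightarrow> 0 < measure M {a<..<b}" and A: "A \<in> null_sets lborel" "AE x in M. x \<in> A"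
    by (rule singular_distribution_exists) blast
  interpret M: real_distribution M by (rule M)
  let ?M = "uniform_measure M {0..1}"
  have pos: "0 < measure M {0..1}"
    using less_le_trans[OF M(3)[of 0 1] M.finite_measure_mono[of "{0<..<1}" "{0..1}"]] by fastforce
  then have nz: "emeasure M {0..1} \<noteq> 0" by (simp add: M.emeasure_eq_measure)
  have meas: "measure ?M B = measure M ({0..1} \<inter> B) / measure M {0..1}" if "B \<in> sets borel" for B
    using nz that by (intro measure_uniform_measure) auto
  have "real_distribution ?M"
    unfolding real_distribution_def real_distribution_axioms_def
    using nz by (auto intro!: prob_space_uniform_measure)
  moreover have "measure ?M {0..1} = 1" using pos by (simp add: meas)
  moreover have "measure ?M {x} = 0" for x
    using M(2)[of x] M.finite_measure_mono[of "{0..1} \<inter> {x}" "{x}"] measure_nonneg[of M "{0..1} \<inter> {x}"]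
    by (simp add: meas)
  moreover have "0 < measure ?M {a<..<b}" if "0 \<le> a" "a < b" "b \<le> 1" for a b
  proof -
    have "{0..1} \<inter> {a<..<b} = {a<..<b}" using that by auto
    then show ?thesis using M(3)[OF that(2)] pos by (simp add: meas)
  qed
  ultimately obtain s' where s': "homeomorphism {0..1} {0..1} (cdf ?M) s'"
    "\<forall>A \<in> null_sets ?M. {y \<in> {0..1}. s' y \<in> A} \<in> null_sets lborel"
    by (rule homeomorphism_cdf) blast
  have "- A \<in> null_sets M" using A by (subst AE_iff_null_sets) auto
  then have "- A \<in> null_sets ?M"
    using null_set_Int1[of "- A" M "{0..1}"] by (auto simp: null_sets_def emeasure_uniform_measure)
  from bspec[OF s'(2) this] show thesis
    by (intro that[OF s'(1) A(1)]) simp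
qed


section \<open>Borel sets and prevalence in homeomorphism groups\<close>

lemma space_borel_sigma: "space (borel_sigma X) = topspace X"
  by (auto simp: borel_sigma_def space_measure_of_conv)

lemma sets_borel_sigma: "sets (borel_sigma X) = sigma_sets (topspace X) {U. openin X U}"
  unfolding borel_sigma_def by (rule sets_measure_of) (auto dest: openin_subset)

lemma openin_in_borel_sigma: "openin X U \<Longrightarrow> U \<in> sets (borel_sigma X)"
  by (auto simp: sets_borel_sigma)

lemma continuous_map_measurable_borel_sigma:
  assumes "continuous_map X Y f"
  shows "f \<in> borel_sigma X \<rightarrow>\<^sub>M borel_sigma Y"
proof (rule measurable_sigma_sets[OF sets_borel_sigma])
  show "f \<in> space (borel_sigma X) \<rightarrow> topspace Y"
    using continuous_map_funspace[OF assms] by (simp add: space_borel_sigma)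
  fix U assume "U \<in> {U. openin Y U}"
  then have "openin X {x \<in> topspace X. f x \<in> U}"
    using assms by (auto intro: openin_continuous_map_preimage)
  moreover have "f -` U \<inter> space (borel_sigma X) = {x \<in> topspace X. f x \<in> U}"
    by (auto simp: space_borel_sigma)
  ultimately show "f -` U \<inter> space (borel_sigma X) \<in> sets (borel_sigma X)"
    by (simp add: openin_in_borel_sigma)
qed (auto dest: openin_subset)

lemma (in group) mem_two_sided_translate_iff:
  assumes "B \<subseteq> carrier G" "g \<in> carrier G" "h \<in> carrier G"
  shows "x \<in> (g <# B) #> h \<longleftrightarrow> x \<in> carrier G \<and> inv g \<otimes> x \<otimes> inv h \<in> B"
proof
  assume "x \<in> (g <# B) #> h"
  then obtain b where b: "b \<in> B" "x = g \<otimes> b \<otimes> h" by (auto simp: l_coset_def r_coset_def)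
  then have "b \<in> carrier G" using assms by auto
  then have "inv g \<otimes> x \<otimes> inv h = b" using b assms by (simp add: m_assoc inv_solve_left')
  with b assms \<open>b \<in> carrier G\<close> show "x \<in> carrier G \<and> inv g \<otimes> x \<otimes> inv h \<in> B" by simp
next
  assume x: "x \<in> carrier G \<and> inv g \<otimes> x \<otimes> inv h \<in> B"
  then have "g \<otimes> (inv g \<otimes> x) = x" using assms by (simp flip: m_assoc)
  then have "x = g \<otimes> (inv g \<otimes> x \<otimes> inv h) \<otimes> h" using assms x by (simp add: m_assoc)
  with x show "x \<in> (g <# B) #> h" unfolding l_coset_def r_coset_def by blast
qed

section \<open>The homeomorphism group and its topology\<close>

lemma Homeo_inverse:
  assumes "f \<in> Homeo S"
  obtains f' where "f' \<in> Homeo S" "homeomorphism S S f f'"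
proof -
  obtain f' where f': "homeomorphism S S f f'" using assms by (auto simp: Homeo_def)
  have h: "homeomorphism S S f (restrict f' S)"
    by (rule homeomorphism_cong[OF f']) auto
  then have "restrict f' S \<in> Homeo S"
    unfolding Homeo_def using homeomorphism_symD[OF h] by auto
  then show thesis using h that by blast
qed

lemma Homeo_compose: "f \<in> Homeo S \<Longrightarrow> g \<in> Homeo S \<Longrightarrow> compose S f g \<in> Homeo S"
  using group.subgroup_self[OF group_homeo_group, of S] group_homeo_group[of S]
  by (metis carrier_homeo_group group.is_monoid monoid.m_closed mult_homeo_group)

lemma Homeo_simps:
  assumes "f \<in> Homeo S"
  shows "continuous_on S f" "f ` S = S" "x \<in> S \<Longrightarrow> f x \<in> S"
  using assms by (auto simp: Homeo_def homeomorphism_def)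

lemma dist_le_homeo_dist:
  assumes "compact S" "f \<in> Homeo S" "g \<in> Homeo S" "x \<in> S"
  shows "dist (f x) (g x) \<le> homeo_dist S f g"
proof -
  have "S \<noteq> {}" using assms(4) by auto
  from homeo_dist_attained[OF assms(1) this assms(2,3)] assms(4) show ?thesis by auto
qed

lemma homeo_dist_le:
  assumes "S \<noteq> {}" "f \<in> Homeo S" "g \<in> Homeo S" "\<And>x. x \<in> S \<Longrightarrow> dist (f x) (g x) \<le> r"
  shows "homeo_dist S f g \<le> r"
  using assms by (simp add: homeo_dist_def cSUP_least)

lemma topspace_homeo_topology:
  "compact S \<Longrightarrow> S \<noteq> {} \<Longrightarrow> topspace (homeo_topology S) = Homeo S"
  by (simp add: homeo_topology_def Metric_space.topspace_mtopology Metric_space_homeo)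

lemma openin_homeo_topology:
  assumes "compact S" "S \<noteq> {}"
  shows "openin (homeo_topology S) U \<longleftrightarrow>
    U \<subseteq> Homeo S \<and> (\<forall>f\<in>U. \<exists>r>0. \<forall>g\<in>Homeo S. homeo_dist S f g < r \<longrightarrow> g \<in> U)"
  unfolding homeo_topology_def Metric_space.openin_mtopology[OF Metric_space_homeo[OF assms]]
    Metric_space.mball_def[OF Metric_space_homeo[OF assms]]
  by blast

text \<open>Precomposition with \<open>h\<close> does not increase the uniform distance, and
  postcomposition with \<open>g\<close> is controlled by the uniform continuity of \<open>g\<close>
  on the compact \<open>S\<close>.\<close>

lemma continuous_map_homeo_translate:
  assumes S: "compact S" "S \<noteq> {}" and g: "g \<in> Homeo S" and h: "h \<in> Homeo S"
  shows "continuous_map (homeo_topology S) (homeo_topology S) (\<lambda>f. compose S g (compose S f h))"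
  unfolding homeo_topology_def
    Metric_space.metric_continuous_map[OF Metric_space_homeo[OF S] Metric_space_homeo[OF S]]
proof (intro conjI ballI allI impI)
  show "(\<lambda>f. compose S g (compose S f h)) ` Homeo S \<subseteq> Homeo S"
    using g h by (auto intro: Homeo_compose)
  fix a and \<epsilon> :: real assume a: "a \<in> Homeo S" and e: "0 < \<epsilon>"
  have "uniformly_continuous_on S g"
    by (rule compact_uniformly_continuous[OF Homeo_simps(1)[OF g] S(1)])
  \<comment> \<open>The supremum inherits only a weak inequality, so half of \<epsilon> is
    requested.\<close>
  moreover have "0 < \<epsilon> / 2" using e by simp
  ultimately obtain d where d: "d > 0"
    "\<And>x y. x \<in> S \<Longrightarrow> y \<in> S \<Longrightarrow> dist y x < d \<Longrightarrow> dist (g y) (g x) < \<epsilon> / 2"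
    by (rule uniformly_continuous_onE) blast
  show "\<exists>\<delta>>0. \<forall>x. x \<in> Homeo S \<and> homeo_dist S a x < \<delta> \<longrightarrow>
    homeo_dist S (compose S g (compose S a h)) (compose S g (compose S x h)) < \<epsilon>"
  proof (intro exI[of _ d] conjI d allI impI)
    fix f assume f: "f \<in> Homeo S \<and> homeo_dist S a f < d"
    have "homeo_dist S (compose S g (compose S a h)) (compose S g (compose S f h)) \<le> \<epsilon> / 2"
    proof (rule homeo_dist_le)
      fix x assume x: "x \<in> S"
      then have hx: "h x \<in> S" by (rule Homeo_simps[OF h])
      have "dist (a (h x)) (f (h x)) < d"
        using dist_le_homeo_dist[OF S(1) a conjunct1[OF f] hx] f by simp
      then have "dist (g (a (h x))) (g (f (h x))) < \<epsilon> / 2"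
        using Homeo_simps(3)[OF a hx] Homeo_simps(3)[OF conjunct1[OF f] hx] by (intro d(2))
      then show "dist (compose S g (compose S a h) x) (compose S g (compose S f h) x) \<le> \<epsilon> / 2"
        using x by (simp add: compose_def)
    qed (use S a f g h in \<open>auto intro: Homeo_compose\<close>)
    then show "homeo_dist S (compose S g (compose S a h)) (compose S g (compose S f h)) < \<epsilon>"
      using e by simp
  qed
qed

text \<open>Joint continuity is uniform on a closed ball of parameters times the compact
  \<open>S\<close>. Hence \<open>\<Phi>\<close> is even continuous for the uniform metric.\<close>

lemma measurable_homeo_family:
  fixes \<Phi> :: "'p::euclidean_space \<Rightarrow> 'a::metric_space \<Rightarrow> 'a"
  assumes S: "compact S" "S \<noteq> {}" and \<Phi>: "\<And>p. \<Phi> p \<in> Homeo S"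
    and cont: "continuous_on (UNIV \<times> S) (\<lambda>(p, x). \<Phi> p x)"
  shows "\<Phi> \<in> borel \<rightarrow>\<^sub>M borel_sigma (homeo_topology S)"
proof (rule measurable_sigma_sets[OF sets_borel_sigma])
  show "\<Phi> \<in> space borel \<rightarrow> topspace (homeo_topology S)"
    using \<Phi> S by (simp add: topspace_homeo_topology)
  fix U assume U: "U \<in> {U. openin (homeo_topology S) U}"
  have "open (\<Phi> -` U)"
    unfolding open_dist
  proof
    fix p0 assume "p0 \<in> \<Phi> -` U"
    then obtain r where r: "r > 0" "\<And>g. g \<in> Homeo S \<Longrightarrow> homeo_dist S (\<Phi> p0) g < r \<Longrightarrow> g \<in> U"
      using U by (auto simp: openin_homeo_topology[OF S])
    have "uniformly_continuous_on (cball p0 1 \<times> S) (\<lambda>(p, x). \<Phi> p x)"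
      by (intro compact_uniformly_continuous continuous_on_subset[OF cont] compact_Times S) auto
    moreover have "0 < r / 2" using r by simp
    ultimately obtain d where d: "d > 0" "\<And>z z'. z \<in> cball p0 1 \<times> S \<Longrightarrow> z' \<in> cball p0 1 \<times> S \<Longrightarrow>
      dist z' z < d \<Longrightarrow> dist ((\<lambda>(p, x). \<Phi> p x) z') ((\<lambda>(p, x). \<Phi> p x) z) < r / 2"
      by (rule uniformly_continuous_onE) blast
    show "\<exists>e>0. \<forall>p. dist p p0 < e \<longrightarrow> p \<in> \<Phi> -` U"
    proof (intro exI[of _ "min d 1"] conjI allI impI)
      fix p assume p: "dist p p0 < min d 1"
      have "homeo_dist S (\<Phi> p0) (\<Phi> p) \<le> r / 2"
      proof (rule homeo_dist_le)
        fix x assume "x \<in> S"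
        then show "dist (\<Phi> p0 x) (\<Phi> p x) \<le> r / 2"
          using d(2)[of "(p, x)" "(p0, x)"] p by (auto simp: dist_Pair_Pair dist_commute)
      qed (use S \<Phi> in auto)
      then show "p \<in> \<Phi> -` U" using r \<Phi> by auto
    qed (use d in auto)
  qed
  then show "\<Phi> -` U \<inter> space borel \<in> sets borel" by simp
qed (auto dest: openin_subset)

text \<open>The measure witnessing Haar nullness is the law of \<open>\<Phi>\<close>. A two-sided
  translate of the complement of \<open>A\<close> is the preimage of that complement under
  \<open>f \<mapsto> g^-1 f h^-1\<close>, hence Borel. The hypothesis \<open>AE\<close>, taken at
  the inverses of \<open>g\<close> and \<open>h\<close>, makes it null.\<close>

lemma prevalent_homeo_groupI:
  assumes S: "compact S" "S \<noteq> {}" and A: "A \<in> sets (borel_sigma (homeo_topology S))"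
    and \<tau>: "prob_space \<tau>" and \<Phi>: "\<Phi> \<in> \<tau> \<rightarrow>\<^sub>M borel_sigma (homeo_topology S)"
    and AE: "\<And>g h. g \<in> Homeo S \<Longrightarrow> h \<in> Homeo S \<Longrightarrow> AE p in \<tau>. compose S g (compose S (\<Phi> p) h) \<in> A"
  shows "prevalent (homeo_group S) (homeo_topology S) A"
proof -
  let ?X = "homeo_topology S" and ?G = "homeo_group S"
  let ?\<mu> = "distr \<tau> (borel_sigma ?X) \<Phi>"
  interpret G: group ?G by (rule group_homeo_group)
  have sp: "space (borel_sigma ?X) = Homeo S"
    using S by (simp add: space_borel_sigma topspace_homeo_topology)
  have AH: "A \<subseteq> Homeo S" using sets.sets_into_space[OF A] by (simp add: sp)
  define B where "B = Homeo S - A"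
  have B: "B \<in> sets (borel_sigma ?X)"
    unfolding B_def sp[symmetric] using A by (rule sets.compl_sets)
  have "(g <#\<^bsub>?G\<^esub> B) #>\<^bsub>?G\<^esub> h \<in> null_sets ?\<mu>" if gh: "g \<in> Homeo S" "h \<in> Homeo S" for g h
  proof -
    let ?g = "inv\<^bsub>?G\<^esub> g" and ?h = "inv\<^bsub>?G\<^esub> h"
    let ?T = "\<lambda>f. compose S ?g (compose S f ?h)"
    have gh': "?g \<in> Homeo S" "?h \<in> Homeo S"
      using gh G.inv_closed[of g] G.inv_closed[of h] by simp_all
    have eq: "(g <#\<^bsub>?G\<^esub> B) #>\<^bsub>?G\<^esub> h = ?T -` B \<inter> space (borel_sigma ?X)"
    proof (rule Set.set_eqI)
      fix f
      have "?g \<otimes>\<^bsub>?G\<^esub> f \<otimes>\<^bsub>?G\<^esub> ?h = ?T f" if "f \<in> Homeo S"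
        using gh' that by (subst G.m_assoc) (auto simp: mult_homeo_group Homeo_compose)
      then show "f \<in> (g <#\<^bsub>?G\<^esub> B) #>\<^bsub>?G\<^esub> h \<longleftrightarrow> f \<in> ?T -` B \<inter> space (borel_sigma ?X)"
        using gh by (subst G.mem_two_sided_translate_iff) (auto simp: sp B_def)
    qed
    have T: "?T \<in> borel_sigma ?X \<rightarrow>\<^sub>M borel_sigma ?X"
      by (intro continuous_map_measurable_borel_sigma continuous_map_homeo_translate S gh')
    then have meas: "?T -` B \<inter> space (borel_sigma ?X) \<in> sets (borel_sigma ?X)"
      using B by (rule measurable_sets)
    have "\<Phi> -` (?T -` B \<inter> space (borel_sigma ?X)) \<inter> space \<tau> \<in> null_sets \<tau>"
    proof (subst AE_iff_null_sets)
      show "\<Phi> -` (?T -` B \<inter> space (borel_sigma ?X)) \<inter> space \<tau> \<in> sets \<tau>"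
        using \<Phi> meas by (rule measurable_sets)
      show "AE p in \<tau>. p \<notin> \<Phi> -` (?T -` B \<inter> space (borel_sigma ?X)) \<inter> space \<tau>"
        using AE[OF gh'] by (auto simp: B_def)
    qed
    then show ?thesis
      unfolding eq using meas by (simp add: null_sets_distr_iff[OF \<Phi>])
  qed
  moreover have "prob_space ?\<mu>" using \<tau> \<Phi> by (rule prob_space.prob_space_distr)
  ultimately have "haar_null ?G ?X B"
    unfolding haar_null_def using B by (auto simp: B_def intro!: exI[of _ ?\<mu>] exI[of _ B])
  then show ?thesis using AH by (simp add: prevalent_def B_def)
qed

text \<open>Outer regularity gives an open \<open>U\<close> of measure below \<open>e\<close> around
  the image of \<open>K\<close>. By compactness a whole \<open>r\<close>-neighbourhood of the image
  stays in \<open>U\<close>, and it contains the image of \<open>K\<close> under every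
  \<open>g\<close> closer than \<open>r\<close> to \<open>f\<close>.\<close>

lemma openin_homeo_image_measure_less:
  fixes S :: "'a::euclidean_space set"
  assumes S: "compact S" "S \<noteq> {}" and K: "compact K" "K \<subseteq> S"
  shows "openin (homeo_topology S) {f \<in> Homeo S. emeasure lborel (f ` K) < ennreal e}"
  unfolding openin_homeo_topology[OF S]
proof (intro conjI ballI)
  fix f assume f: "f \<in> {f \<in> Homeo S. emeasure lborel (f ` K) < ennreal e}"
  then have fH: "f \<in> Homeo S" by simp
  have fK: "compact (f ` K)"
    by (intro compact_continuous_image continuous_on_subset[OF Homeo_simps(1)[OF fH]] K)
  then obtain m where m: "emeasure lborel (f ` K) = ennreal m" "m \<ge> 0"
    using emeasure_compact_finite[OF fK] by (cases "emeasure lborel (f ` K)") auto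
  then have me: "m < e" using f by (simp add: ennreal_less_iff)
  have "f ` K \<in> sets borel" "0 < e - m" using me fK by (auto intro: borel_compact)
  then obtain U where U: "open U" "f ` K \<subseteq> U" "emeasure lborel (U - f ` K) < ennreal (e - m)"
    by (rule outer_regular_lborel)
  have "emeasure lborel U = emeasure lborel (f ` K) + emeasure lborel (U - f ` K)"
    using U fK by (subst plus_emeasure) (auto simp: borel_compact Un_absorb1)
  also have "\<dots> < ennreal m + ennreal (e - m)"
    unfolding m(1) using U(3) by (simp add: ennreal_add_left_cancel_less)
  also have "\<dots> = ennreal e" using m me by (simp flip: ennreal_plus)
  finally have Ue: "emeasure lborel U < ennreal e" .
  obtain r where r: "r > 0" "(\<Union>y\<in>f ` K. ball y r) \<subseteq> U"
    using compact_subset_open_imp_ball_epsilon_subset[OF fK U(1,2)] by blast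
  show "\<exists>r>0. \<forall>g\<in>Homeo S. homeo_dist S f g < r \<longrightarrow> g \<in> {f \<in> Homeo S. emeasure lborel (f ` K) < ennreal e}"
  proof (intro exI[of _ r] conjI r ballI impI CollectI)
    fix g assume g: "g \<in> Homeo S" "homeo_dist S f g < r"
    have "g ` K \<subseteq> U"
    proof clarify
      fix x assume x: "x \<in> K"
      then have "dist (f x) (g x) < r"
        using dist_le_homeo_dist[OF S(1) fH g(1), of x] g(2) K(2) by auto
      then have "g x \<in> ball (f x) r" by simp
      then show "g x \<in> U" using r(2) x by blast
    qed
    then have "emeasure lborel (g ` K) \<le> emeasure lborel U"
      using U(1) by (intro emeasure_mono) auto
    then show "emeasure lborel (g ` K) < ennreal e" using Ue by simp
  qed
qed auto


section \<open>The set of singular homeomorphisms is Borel\<close>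

lemma emeasure_unit_cube: "emeasure lborel (unit_cube :: (real ^ 'n) set) = 1"
proof -
  have "(1 :: real ^ 'n) \<bullet> b = 1" if "b \<in> Basis" for b
    using that by (auto simp: Basis_vec_def inner_axis)
  then show ?thesis by (simp add: emeasure_lborel_cbox_eq)
qed

lemma unit_cube_nonempty: "(unit_cube :: (real ^ 'n) set) \<noteq> {}"
  using mem_unit_cube[of "0 :: real ^ 'n"] by (simp add: ex_in_conv[symmetric] exI[of _ 0])

text \<open>
  This exhibits the set of singular homeomorphisms as a countable intersection of open sets.
\<close>

lemma singular_homeo_iff:
  fixes f :: "real ^ 'n \<Rightarrow> real ^ 'n"
  shows "singular_homeo f \<longleftrightarrow> f \<in> Homeo unit_cube \<and>
    (\<forall>n. \<exists>K. compact K \<and> K \<subseteq> unit_cube \<and> emeasure lborel (unit_cube - K) < ennreal ((1/2) ^ n) \<and>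
      emeasure lborel (f ` K) < ennreal ((1/2) ^ n))" (is "_ \<longleftrightarrow> _ \<and> (\<forall>n. \<exists>K. ?P n K)")
proof (intro iffI conjI allI; (elim conjE)?)
  assume "singular_homeo f"
  then show "f \<in> Homeo unit_cube" by (simp add: singular_homeo_def)
next
  fix n assume "singular_homeo f"
  then obtain F where F: "F \<in> sets borel" "F \<subseteq> unit_cube" "emeasure lborel F = 1"
    "f ` F \<in> null_sets lborel" by (auto simp: singular_homeo_def)
  have "F \<in> sets lebesgue" "0 < (1/2::real) ^ n" using F(1) by auto
  then obtain K where K: "closed K" "K \<subseteq> F" "emeasure lebesgue (F - K) < ennreal ((1/2) ^ n)"
    by (rule sets_lebesgue_inner_closed)
  have cK: "compact K" using K F(2) compact_Int_closed[OF compact_cbox K(1), of 0 1]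
    by (metis Int_absorb1 subset_trans)
  have "emeasure lborel (unit_cube - F) = 0"
    using F by (subst emeasure_Diff) (auto simp: emeasure_unit_cube)
  then have "unit_cube - F \<in> null_sets lborel" using F(1) by auto
  then have "emeasure lborel ((F - K) \<union> (unit_cube - F)) = emeasure lborel (F - K)"
    using F(1) K(1) by (intro emeasure_Un_null_set) auto
  moreover have "(F - K) \<union> (unit_cube - F) = unit_cube - K" using F(2) K(2) by auto
  moreover have "emeasure lebesgue (F - K) = emeasure lborel (F - K)"
    using F(1) K(1) by auto
  moreover have "emeasure lborel (f ` K) \<le> emeasure lborel (f ` F)"
    using F(4) K(2) by (intro emeasure_mono image_mono) auto
  then have "emeasure lborel (f ` K) = 0" using F(4) by auto
  ultimately show "\<exists>K. ?P n K" using K F(2) cK by (intro exI[of _ K]) auto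
next
  assume fH: "f \<in> Homeo unit_cube" and "\<forall>n. \<exists>K. ?P n K"
  then obtain K where K: "\<And>n. ?P n (K n)" by metis
  then have cK: "compact (K n)" "closed (K n)" "K n \<in> sets borel" for n
    by (auto intro: compact_imp_closed borel_compact)
  \<comment> \<open>The lower limit of the sets \<open>K n\<close> serves as the full set in the
    definition. The bounds \<open>(1/2) ^ n\<close> are summable, so by Borel-Cantelli almost every
    point of the cube lies in some \<open>?L m\<close>. As \<open>?L m\<close> is inside
    \<open>K n\<close> for all \<open>n \<ge> m\<close>, its image is null.\<close>
  let ?L = "\<lambda>m. \<Inter>n\<in>{m..}. K n"
  have cL: "compact (?L m)" for m
    using cK compact_Int_closed[OF cK(1)[of m], of "?L m"] by (auto simp: Int_absorb1 INT_lower)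
  have "AE x in lborel. eventually (\<lambda>n. x \<in> space lborel - (unit_cube - K n)) sequentially"
  proof (rule borel_cantelli_AE1)
    show "unit_cube - K n \<in> sets lborel" for n using cK by simp
    show "emeasure lborel (unit_cube - K n) < \<infinity>" for n
      using K[of n] by (auto intro: less_trans)
    have "measure lborel (unit_cube - K n) \<le> (1/2) ^ n" for n
      unfolding measure_def using K[of n] by (intro enn2real_leI) auto
    then show "summable (\<lambda>n. measure lborel (unit_cube - K n))"
      by (intro summable_comparison_test'[OF summable_geometric[of "1/2::real"], of 0]) auto
  qed
  then have "AE x in lborel. x \<in> unit_cube \<longrightarrow> x \<in> (\<Union>m. ?L m)"
    by eventually_elim (auto simp: eventually_sequentially)
  moreover have sub: "(\<Union>m. ?L m) \<subseteq> unit_cube" using K by blast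
  moreover have bL: "(\<Union>m. ?L m) \<in> sets borel" using cL by (auto intro: borel_compact)
  ultimately have "emeasure lborel (\<Union>m. ?L m) = emeasure lborel (unit_cube :: (real ^ 'n) set)"
    by - (rule emeasure_eq_AE, auto elim!: eventually_mono)
  moreover have "f ` (\<Union>m. ?L m) \<in> null_sets lborel"
    unfolding image_UN
  proof (rule null_sets_UN)
    fix m
    have cf: "compact (f ` ?L m)"
      using K by (intro compact_continuous_image cL continuous_on_subset[OF Homeo_simps(1)[OF fH]]) blast
    have "emeasure lborel (f ` ?L m) \<le> ennreal ((1/2) ^ n)" if "n \<ge> m" for n
    proof -
      have "compact (f ` K n)"
        using K by (intro compact_continuous_image cK continuous_on_subset[OF Homeo_simps(1)[OF fH]]) blast
      then have "emeasure lborel (f ` ?L m) \<le> emeasure lborel (f ` K n)"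
        using that by (intro emeasure_mono) (auto intro: borel_compact)
      then show ?thesis using K[of n] by (meson less_imp_le order_trans)
    qed
    moreover have "(\<lambda>n. ennreal ((1/2) ^ n)) \<longlonglongrightarrow> ennreal 0"
      by (intro tendsto_ennrealI LIMSEQ_power_zero) simp
    ultimately have "emeasure lborel (f ` ?L m) \<le> ennreal 0"
      by (intro tendsto_lowerbound[of "\<lambda>n. ennreal ((1/2) ^ n)" _ sequentially])
         (auto intro!: eventually_sequentiallyI[of m])
    then show "f ` ?L m \<in> null_sets lborel" using borel_compact[OF cf] by (intro null_setsI) auto
  qed
  ultimately show "singular_homeo f"
    unfolding singular_homeo_def using fH sub bL emeasure_unit_cube by metis
qed

text \<open>The union over \<open>K\<close> may be uncountable, but its members are open; the
  intersection over \<open>n\<close> is countable.\<close>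

lemma singular_homeo_borel:
  "{f :: real ^ 'n \<Rightarrow> _. singular_homeo f} \<in> sets (borel_sigma (homeo_topology unit_cube))"
proof -
  let ?X = "homeo_topology (unit_cube :: (real ^ 'n) set)"
  let ?K = "\<lambda>n::nat. {K. compact K \<and> K \<subseteq> (unit_cube :: (real ^ 'n) set) \<and>
    emeasure lborel (unit_cube - K) < ennreal ((1/2) ^ n)}"
  let ?O = "\<lambda>n. \<Union>K\<in>?K n. {f \<in> Homeo unit_cube. emeasure lborel (f ` K) < ennreal ((1/2) ^ n)}"
  have "{f :: real ^ 'n \<Rightarrow> _. singular_homeo f} = (\<Inter>n. ?O n)"
    by (auto simp: singular_homeo_iff)
  also have "\<dots> \<in> sets (borel_sigma ?X)"
    using unit_cube_nonempty
    by (intro sets.countable_INT image_subsetI openin_in_borel_sigma openin_Union ballI)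
       (auto intro!: openin_homeo_image_measure_less)
  finally show ?thesis .
qed


section \<open>A singular homeomorphism of the unit cube\<close>

lemma borel_measurable_vec_iff:
  fixes f :: "'a \<Rightarrow> real ^ 'n"
  shows "f \<in> borel_measurable M \<longleftrightarrow> (\<forall>i. (\<lambda>x. f x $ i) \<in> borel_measurable M)"
  by (auto simp: borel_measurable_euclidean_space[of f] Basis_vec_def inner_axis)

lemma negligible_lborel_iff: "N \<in> sets borel \<Longrightarrow> negligible N \<longleftrightarrow> N \<in> null_sets lborel"
  by (simp add: negligible_iff_null_sets null_sets_completion_iff)

text \<open>By Tonelli the measure of the slab is a product over the basis whose factor at the
  \<open>i\<close>-th axis is the measure of \<open>N\<close>.\<close>

lemma null_sets_coordinate:
  assumes N: "N \<in> null_sets lborel"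
  shows "{x :: real ^ 'n. x $ i \<in> N} \<in> null_sets lborel"
proof -
  have [measurable]: "N \<in> sets borel" using N by auto
  have [measurable]: "(\<lambda>x :: real ^ 'n. x $ i) \<in> borel_measurable borel"
    using borel_measurable_vec_iff[of "\<lambda>x :: real ^ 'n. x"] by auto
  define f :: "real ^ 'n \<Rightarrow> real \<Rightarrow> real" where
    "f b = (if b = axis i 1 then indicator N else (\<lambda>_. 1))" for b
  have i: "axis i 1 \<in> (Basis :: (real ^ 'n) set)" by (auto simp: Basis_vec_def)
  have "emeasure lborel {x :: real ^ 'n. x $ i \<in> N} = (\<integral>\<^sup>+x. indicator {x :: real ^ 'n. x $ i \<in> N} x \<partial>lborel)"
    by simp
  also have "\<dots> = (\<integral>\<^sup>+x. ennreal (\<Prod>b\<in>Basis. f b (x \<bullet> b)) \<partial>(lborel :: (real ^ 'n) measure))"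
  proof (intro nn_integral_cong)
    fix x :: "real ^ 'n"
    have "(\<Prod>b\<in>Basis. f b (x \<bullet> b)) = (\<Prod>b\<in>Basis. if b = axis i 1 then indicator N (x \<bullet> b) else 1)"
      by (intro prod.cong) (auto simp: f_def)
    also have "\<dots> = indicator N (x $ i)"
      using i by (simp add: prod.delta inner_axis)
    finally show "indicator {x. x $ i \<in> N} x = ennreal (\<Prod>b\<in>Basis. f b (x \<bullet> b))"
      by (simp split: split_indicator)
  qed
  also have "\<dots> = (\<integral>\<^sup>+x. (\<Prod>b\<in>Basis. ennreal (f b (x \<bullet> b))) \<partial>(lborel :: (real ^ 'n) measure))"
    by (simp add: prod_ennreal f_def)
  also have "\<dots> = (\<Prod>b\<in>Basis. (\<integral>\<^sup>+x. ennreal (f b x) \<partial>lborel))"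
    by (intro nn_integral_lborel_prod) (auto simp: f_def)
  \<comment> \<open>Every other factor is infinite; in \<open>ennreal\<close> a product with a zero
    factor is zero all the same.\<close>
  also have "\<dots> = 0"
  proof (rule prod_zero)
    have "(\<integral>\<^sup>+x. ennreal (f (axis i 1) x) \<partial>lborel) = (\<integral>\<^sup>+x. indicator N x \<partial>lborel)"
      by (intro nn_integral_cong) (auto simp: f_def split: split_indicator)
    also have "\<dots> = 0" using N by (simp add: null_setsD1)
    finally show "\<exists>b\<in>(Basis :: (real ^ 'n) set). (\<integral>\<^sup>+x. ennreal (f b x) \<partial>lborel) = 0"
      using i by blast
  qed simp
  finally show ?thesis by (auto simp: null_sets_def)
qed

lemma homeomorphism_coordinatewise:
  assumes "\<And>i. homeomorphism {0..1} {0..1} (\<phi> i) (\<psi> i)"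
  shows "homeomorphism unit_cube unit_cube (\<lambda>x :: real ^ 'n. \<chi> i. \<phi> i (x $ i)) (\<lambda>x. \<chi> i. \<psi> i (x $ i))"
proof -
  note h = assms[unfolded homeomorphism_def]
  have *: "continuous_on unit_cube (\<lambda>x :: real ^ 'n. \<chi> i. f i (x $ i))"
    if "\<And>i. continuous_on {0..1} (f i)" for f :: "'n \<Rightarrow> real \<Rightarrow> real"
    by (intro continuous_on_vec_lambda continuous_on_compose2[OF that] continuous_intros)
       (auto simp: mem_unit_cube)
  have in01: "\<phi> i y \<in> {0..1}" "\<psi> i y \<in> {0..1}" if "y \<in> {0..1}" for i y
    using h[of i] that by blast+
  show ?thesis
  proof (rule homeomorphismI)
    show "(\<lambda>x :: real ^ 'n. \<chi> i. \<phi> i (x $ i)) ` unit_cube \<subseteq> unit_cube"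
      "(\<lambda>x :: real ^ 'n. \<chi> i. \<psi> i (x $ i)) ` unit_cube \<subseteq> unit_cube"
      using in01 by (auto simp: mem_unit_cube)
  qed (use h in \<open>auto intro!: * simp: vec_eq_iff mem_unit_cube\<close>)
qed

lemma restrict_in_Homeo:
  assumes "homeomorphism S S f f'"
  shows "restrict f S \<in> Homeo S" "homeomorphism S S (restrict f S) (restrict f' S)"
proof -
  show *: "homeomorphism S S (restrict f S) (restrict f' S)"
    by (rule homeomorphism_cong[OF assms]) auto
  then show "restrict f S \<in> Homeo S" by (auto simp: Homeo_def)
qed

lemma Homeo_borel_measurable:
  assumes f: "f \<in> Homeo S" and S: "closed S"
  shows "f \<in> borel_measurable borel"
proof -
  have "f = (\<lambda>x. if x \<in> S then f x else undefined)"
    using f by (auto simp: Homeo_def extensional_def)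
  moreover have "\<dots> \<in> borel_measurable borel"
    using S by (intro borel_measurable_continuous_on_if Homeo_simps(1)[OF f]) auto
  ultimately show ?thesis by simp
qed

text \<open>Invariance of domain makes the image of the open box open, so it lies in the interior of
  the cube. This keeps points in the region where the flow acts freely.\<close>

lemma Homeo_unit_cube_box:
  assumes f: "f \<in> Homeo (unit_cube :: (real ^ 'n) set)" and x: "x \<in> box 0 1"
  shows "f x \<in> box 0 1"
proof -
  have sub: "box 0 1 \<subseteq> (unit_cube :: (real ^ 'n) set)" by (rule box_subset_cbox)
  have "inj_on f unit_cube" using f Homeo_subset_Bij by (auto simp: Bij_def bij_betw_def)
  then have "open (f ` box 0 1)"
    using sub Homeo_simps(1)[OF f]
    by (intro invariance_of_domain open_box) (auto intro: continuous_on_subset inj_on_subset)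
  moreover have "f ` box 0 1 \<subseteq> unit_cube" using sub Homeo_simps(2)[OF f] by blast
  ultimately have "f ` box 0 1 \<subseteq> interior unit_cube" by (intro interior_maximal)
  then show ?thesis using x by (auto simp: interior_cbox)
qed

lemma singular_Homeo_exists:
  obtains s s' :: "real ^ 'n \<Rightarrow> real ^ 'n" and A where
    "s \<in> Homeo unit_cube" "s' \<in> Homeo unit_cube" "homeomorphism unit_cube unit_cube s s'"
    "A \<in> null_sets lborel" "{y \<in> unit_cube. s' y \<notin> A} \<in> null_sets lborel"
proof -
  obtain r r' :: "real \<Rightarrow> real" and A where r: "homeomorphism {0..1} {0..1} r r'" and
    A: "A \<in> null_sets lborel" "{y \<in> {0..1}. r' y \<notin> A} \<in> null_sets lborel"
    by (rule singular_homeomorphism_interval)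
  let ?s = "restrict (\<lambda>x :: real ^ 'n. \<chi> i. r (x $ i)) unit_cube"
  let ?s' = "restrict (\<lambda>x :: real ^ 'n. \<chi> i. r' (x $ i)) unit_cube"
  \<comment> \<open>The interval homeomorphism acts on all coordinates, but a single one yields the
    witness: the slab over \<open>A\<close> in direction \<open>i0\<close> is null, and its
    complement in the cube has null image.\<close>
  fix i0 :: 'n
  have h: "homeomorphism unit_cube unit_cube (\<lambda>x :: real ^ 'n. \<chi> i. r (x $ i)) (\<lambda>x. \<chi> i. r' (x $ i))"
    using r by (rule homeomorphism_coordinatewise)
  have eq: "{y \<in> unit_cube. ?s' y \<notin> {x. x $ i0 \<in> A}} =
    {y :: real ^ 'n. y $ i0 \<in> {y \<in> {0..1}. r' y \<notin> A}} \<inter> unit_cube"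
    by (auto simp: mem_unit_cube)
  show thesis
  proof (rule that[of ?s ?s' "{x. x $ i0 \<in> A}"])
    show "{y \<in> unit_cube. ?s' y \<notin> {x. x $ i0 \<in> A}} \<in> null_sets lborel"
      unfolding eq by (intro null_set_Int2 null_sets_coordinate A) simp
  qed (use restrict_in_Homeo[OF h] restrict_in_Homeo[OF homeomorphism_symD[OF h]]
         null_sets_coordinate[OF A(1)] in auto)
qed


section \<open>A smooth action of translations on the cube\<close>

text \<open>In the coordinates \<open>ln (x / (1 - x))\<close> this is translation by \<open>-t\<close>.\<close>

definition flow :: "real ^ 'n \<Rightarrow> real ^ 'n \<Rightarrow> real ^ 'n" where
  "flow t x = (\<chi> i. x $ i / (x $ i + exp (t $ i) * (1 - x $ i)))"

text \<open>Positivity on the closed interval makes \<open>flow\<close> continuous up to the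
  boundary of the cube, where the logarithmic coordinates become infinite.\<close>

lemma flow_denominator_pos:
  fixes x t :: real
  assumes "0 \<le> x" "x \<le> 1"
  shows "0 < x + exp t * (1 - x)"
proof (cases "x = 0")
  case False
  then show ?thesis using assms by (intro add_pos_nonneg) auto
qed simp

lemma flow_in_cube: "x \<in> unit_cube \<Longrightarrow> flow t x \<in> unit_cube"
  using flow_denominator_pos by (auto simp: mem_unit_cube flow_def divide_simps less_imp_le)

lemma flow_in_box: "x \<in> box 0 1 \<Longrightarrow> flow t x \<in> box 0 1"
  using flow_denominator_pos by (auto simp: mem_box_cart flow_def divide_simps less_imp_le)

lemma flow_minus:
  assumes "x \<in> unit_cube"
  shows "flow (- t) (flow t x) = x"
proof -
  have "flow (- t) (flow t x) $ i = x $ i" for i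
  proof -
    have x: "0 \<le> x $ i" "x $ i \<le> 1" using assms by (auto simp: mem_unit_cube)
    let ?D = "x $ i + exp (t $ i) * (1 - x $ i)"
    have D: "?D > 0" by (rule flow_denominator_pos[OF x])
    have "1 - x $ i / ?D = exp (t $ i) * (1 - x $ i) / ?D" using D by (simp add: field_simps)
    moreover have "exp (- t $ i) * (exp (t $ i) * (1 - x $ i) / ?D) = (1 - x $ i) / ?D"
      by (simp add: exp_minus)
    ultimately have "x $ i / ?D + exp (- t $ i) * (1 - x $ i / ?D) = x $ i / ?D + (1 - x $ i) / ?D"
      by (simp only:)
    also have "\<dots> = 1 / ?D" by (simp add: add_divide_distrib[symmetric])
    finally have "x $ i / ?D + exp (- t $ i) * (1 - x $ i / ?D) = 1 / ?D" .
    then show ?thesis using D by (simp add: flow_def)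
  qed
  then show ?thesis by (simp add: vec_eq_iff)
qed

lemma flow_minus': "x \<in> unit_cube \<Longrightarrow> flow t (flow (- t) x) = x"
  using flow_minus[of x "- t"] by simp

lemma continuous_on_flow:
  assumes f: "continuous_on X f" and g: "continuous_on X g" and X: "\<And>x. x \<in> X \<Longrightarrow> g x \<in> unit_cube"
  shows "continuous_on X (\<lambda>x. flow (f x) (g x))"
proof -
  have "g x $ i + exp (f x $ i) * (1 - g x $ i) \<noteq> 0" if "x \<in> X" for x i
    using flow_denominator_pos[of "g x $ i" "f x $ i"] X[OF that] by (auto simp: mem_unit_cube)
  then show ?thesis
    unfolding flow_def by (intro continuous_intros f g) auto
qed

lemma homeomorphism_flow: "homeomorphism unit_cube unit_cube (flow t) (flow (- t))"
  by (rule homeomorphismI)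
     (auto intro!: continuous_on_flow continuous_intros flow_in_cube simp: flow_minus flow_minus')

lemma borel_measurable_flow [measurable]:
  assumes [measurable]: "f \<in> borel_measurable M" "g \<in> borel_measurable M"
  shows "(\<lambda>x. flow (f x) (g x)) \<in> borel_measurable M"
proof -
  have [measurable]: "(\<lambda>x. f x $ i) \<in> borel_measurable M" "(\<lambda>x. g x $ i) \<in> borel_measurable M" for i
    using assms by (auto simp: borel_measurable_vec_iff)
  show ?thesis by (simp add: borel_measurable_vec_iff flow_def)
qed

section \<open>Null sets under the flow and along its orbits\<close>

lemma differentiable_on_coordinatewise:
  fixes f :: "'n::finite \<Rightarrow> real \<Rightarrow> real"
  assumes "\<And>i x. x \<in> X \<Longrightarrow> f i differentiable at (x $ i)"
  shows "(\<lambda>x :: real ^ 'n. \<chi> i. f i (x $ i)) differentiable_on X"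
  unfolding differentiable_on_def
proof (intro ballI)
  fix x assume x: "x \<in> X"
  have "(\<lambda>x. f i (x $ i)) differentiable at x within X" for i
  proof (rule differentiable_compose[where f = "f i" and g = "\<lambda>x. x $ i"])
    show "f i differentiable at (x $ i)" by (rule assms[OF x])
    show "(\<lambda>x. x $ i) differentiable at x within X"
      by (intro bounded_linear_imp_differentiable bounded_linear_vec_nth)
  qed
  then show "(\<lambda>x :: real ^ 'n. \<chi> i. f i (x $ i)) differentiable at x within X"
    by (subst differentiable_componentwise_within) (auto simp: Basis_vec_def inner_axis)
qed

text \<open>The formula is differentiable up to the boundary, and differentiable maps of a Euclidean
  space into itself preserve negligibility.\<close>

lemma negligible_flow_image:
  assumes "negligible N" "N \<subseteq> unit_cube"
  shows "negligible (flow t ` N)"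
proof (rule negligible_differentiable_image_negligible)
  have "(\<lambda>y. y / (y + exp (t $ i) * (1 - y))) differentiable at (x $ i)" if "x \<in> N" for x i
    using flow_denominator_pos[of "x $ i" "t $ i"] assms(2) that
    by (intro derivative_intros) (auto simp: mem_unit_cube)
  then show "flow t differentiable_on N"
    unfolding flow_def[abs_def] by (intro differentiable_on_coordinatewise)
qed (use assms in auto)

text \<open>The preimage lies in the image of the part of \<open>N\<close> in the cube under the
  inverse map \<open>flow (- t)\<close>.\<close>

lemma null_sets_flow_vimage:
  assumes N: "N \<in> null_sets lborel"
  shows "{x \<in> unit_cube. flow t x \<in> N} \<in> null_sets lborel"
proof -
  have [measurable]: "N \<in> sets borel" using N by auto
  have "{x \<in> space borel. x \<in> unit_cube \<and> flow t x \<in> N} \<in> sets borel" by measurable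
  then have *: "{x \<in> unit_cube. flow t x \<in> N} \<in> sets borel" by simp
  have "negligible N" using N by (subst negligible_lborel_iff) auto
  then have "negligible (flow (- t) ` (N \<inter> unit_cube))"
    by (intro negligible_flow_image negligible_Int) auto
  then have "negligible {x \<in> unit_cube. flow t x \<in> N}"
    by (rule negligible_subset) (force simp: flow_in_cube flow_minus image_iff)
  with * show ?thesis by (simp add: negligible_lborel_iff)
qed

text \<open>This is the absolute continuity of a random orbit point. For interior \<open>z\<close>
  the orbit map has a differentiable inverse \<open>?T\<close>, so the parameters hitting
  \<open>N\<close> lie in a differentiable image of a null set.\<close>

lemma null_sets_flow_orbit:
  fixes z :: "real ^ 'n"
  assumes z: "z \<in> box 0 1" and N: "N \<in> null_sets lborel"
  shows "{t. flow t z \<in> N} \<in> null_sets lborel"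
proof -
  have [measurable]: "N \<in> sets borel" using N by auto
  have "{t \<in> space borel. flow t z \<in> N} \<in> sets borel" by measurable
  then have *: "{t. flow t z \<in> N} \<in> sets borel" by simp
  \<comment> \<open>The difference of the logarithmic coordinates of \<open>z\<close> and
    \<open>y\<close> is the parameter whose flow takes \<open>z\<close> to \<open>y\<close>.\<close>
  let ?T = "\<lambda>y :: real ^ 'n. \<chi> i. ln (z $ i / (1 - z $ i)) - ln (y $ i / (1 - y $ i))"
  have "negligible (?T ` (N \<inter> box 0 1))"
  proof (rule negligible_differentiable_image_negligible)
    have "negligible N" using N by (subst negligible_lborel_iff) auto
    then show "negligible (N \<inter> box 0 1)" by (intro negligible_Int) auto
    have "(\<lambda>y. ln (z $ i / (1 - z $ i)) - ln (y / (1 - y))) differentiable at (y $ i)"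
      if "y \<in> box 0 1" for y :: "real ^ 'n" and i
    proof -
      have y: "0 < y $ i" "y $ i < 1" using that by (auto simp: mem_box_cart)
      then show ?thesis
        unfolding real_differentiable_def
        by (intro exI) (rule derivative_eq_intros refl | simp)+
    qed
    then show "?T differentiable_on N \<inter> box 0 1"
      by (intro differentiable_on_coordinatewise) auto
  qed auto
  moreover have "t = ?T (flow t z)" for t
  proof -
    have "t $ i = ln (z $ i / (1 - z $ i)) - ln (flow t z $ i / (1 - flow t z $ i))" for i
    proof -
      have z01: "0 < z $ i" "z $ i < 1" using z by (auto simp: mem_box_cart)
      let ?D = "z $ i + exp (t $ i) * (1 - z $ i)"
      have D: "?D > 0" using flow_denominator_pos[of "z $ i"] z01 by simp
      have "1 - z $ i / ?D = exp (t $ i) * (1 - z $ i) / ?D" using D by (simp add: field_simps)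
      then have "flow t z $ i / (1 - flow t z $ i) = (z $ i / (1 - z $ i)) / exp (t $ i)"
        using D by (simp add: flow_def)
      moreover have "ln (z $ i / (1 - z $ i) / exp (t $ i)) = ln (z $ i / (1 - z $ i)) - t $ i"
        using z01 by (subst ln_div) auto
      ultimately show ?thesis by simp
    qed
    then show ?thesis by (simp add: vec_eq_iff)
  qed
  then have "{t. flow t z \<in> N} \<subseteq> ?T ` (N \<inter> box 0 1)"
    using flow_in_box[OF z] by blast
  ultimately have "negligible {t. flow t z \<in> N}" by (rule negligible_subset)
  with * show ?thesis by (simp add: negligible_lborel_iff)
qed


section \<open>Random homeomorphisms\<close>

text \<open>This is the exhaustion argument behind the Lebesgue decomposition. A countable union of
  null sets nearly maximizing \<nu> attains the supremum over null sets, so no null set has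
  \<nu>-mass left outside \<open>N\<close>.\<close>

lemma null_set_carrying_singular_part:
  assumes \<nu>: "finite_measure \<nu>" "sets \<nu> = sets M"
  obtains N where "N \<in> null_sets M" "\<And>A. A \<in> null_sets M \<Longrightarrow> A - N \<in> null_sets \<nu>"
proof -
  interpret finite_measure \<nu> by fact
  have sets: "A \<in> null_sets M \<Longrightarrow> A \<in> sets \<nu>" for A using \<nu>(2) by auto
  let ?V = "measure \<nu> ` null_sets M"
  have bdd: "bdd_above ?V" by (intro bdd_aboveI[of _ "measure \<nu> (space \<nu>)"]) (auto intro: bounded_measure)
  have ne: "?V \<noteq> {}" by (auto intro: exI[of _ "{}"])
  have "\<exists>A\<in>null_sets M. Sup ?V - 1 / Suc n < measure \<nu> A" for n
    using less_cSup_iff[OF ne bdd, of "Sup ?V - 1 / Suc n"] by auto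
  then obtain A where A: "\<And>n. A n \<in> null_sets M" "\<And>n::nat. Sup ?V - 1 / Suc n < measure \<nu> (A n)"
    by metis
  define N where "N = (\<Union>n. A n)"
  have N: "N \<in> null_sets M" unfolding N_def using A(1) by (rule null_sets_UN)
  have "Sup ?V \<le> measure \<nu> N"
  proof (rule field_le_epsilon)
    fix e :: real assume "0 < e"
    then obtain n where "1 / Suc n < e" using nat_approx_posE by blast
    moreover have "measure \<nu> (A n) \<le> measure \<nu> N"
      using sets[OF N] by (intro finite_measure_mono) (auto simp: N_def)
    ultimately show "Sup ?V \<le> measure \<nu> N + e" using A(2)[of n] by linarith
  qed
  show thesis
  proof
    fix B assume B: "B \<in> null_sets M"
    have "measure \<nu> N + measure \<nu> (B - N) = measure \<nu> (N \<union> B)"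
      using sets[OF N] sets[OF B] finite_measure_Union[of N "B - N"] by (simp add: Un_Diff_cancel)
    also have "\<dots> \<le> Sup ?V" using N B by (intro cSup_upper bdd imageI) auto
    finally have "measure \<nu> (B - N) = 0"
      using \<open>Sup ?V \<le> _\<close> measure_nonneg[of \<nu> "B - N"] by linarith
    then show "B - N \<in> null_sets \<nu>"
      using sets[OF N] sets[OF B] by (intro null_setsI) (auto simp: emeasure_eq_measure)
  qed (rule N)
qed

section \<open>Image measures and exchange of almost-everywhere quantifiers\<close>

text \<open>For \<open>h\<close> and for the inverse of \<open>g\<close> these are the measures
  \<nu> and \<eta> of the outline.\<close>

definition law :: "(real ^ 'n \<Rightarrow> real ^ 'n) \<Rightarrow> (real ^ 'n) measure" where
  "law f = distr (uniform_measure lborel unit_cube) borel f"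

lemma sets_law [simp, measurable_cong]: "sets (law f) = sets borel"
  by (simp add: law_def)

lemma unit_cube_prob_space: "prob_space (uniform_measure lborel (unit_cube :: (real ^ 'n) set))"
  by (rule prob_space_uniform_measure) (simp_all add: emeasure_unit_cube)

lemma law_properties:
  assumes f: "f \<in> Homeo (unit_cube :: (real ^ 'n) set)"
  shows "prob_space (law f)"
    and "AE y in law f. P y \<Longrightarrow> AE x in lborel. x \<in> unit_cube \<longrightarrow> P (f x)"
    and "AE y in law f. y \<in> box 0 1"
proof -
  let ?U = "uniform_measure lborel (unit_cube :: (real ^ 'n) set)"
  have [measurable]: "f \<in> borel_measurable borel" by (rule Homeo_borel_measurable[OF f closed_cbox])
  have m: "f \<in> ?U \<rightarrow>\<^sub>M borel" by measurable
  show "prob_space (law f)"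
    unfolding law_def using unit_cube_prob_space m by (rule prob_space.prob_space_distr)
  show "AE x in lborel. x \<in> unit_cube \<longrightarrow> P (f x)" if "AE y in law f. P y"
    using AE_distrD[OF m that[unfolded law_def]]
    by (subst (asm) AE_uniform_measure) (auto simp: emeasure_unit_cube)
  \<comment> \<open>The boundary is null and homeomorphisms preserve the interior, so the image
    point is almost surely interior.\<close>
  have "unit_cube - box 0 1 \<in> null_sets (lborel :: (real ^ 'n) measure)"
    by (intro null_setsI, subst emeasure_Diff)
       (auto simp: emeasure_unit_cube box_subset_cbox emeasure_lborel_box_eq emeasure_lborel_cbox_eq)
  from AE_not_in[OF this] have "AE x in ?U. x \<in> box 0 1"
    by (intro AE_uniform_measureI) (auto elim!: eventually_mono)
  then have "AE x in ?U. f x \<in> box 0 1"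
    by eventually_elim (rule Homeo_unit_cube_box[OF f])
  then show "AE y in law f. y \<in> box 0 1"
    unfolding law_def using m by (subst AE_distr_iff) auto
qed

text \<open>Fubini exchanges the quantifiers. The product of \<open>lborel\<close> with \<nu>
  carries the Borel sets of the product space, where \<open>F\<close> is measurable.\<close>

lemma AE_swap_notin:
  fixes F :: "'p::euclidean_space \<Rightarrow> 'a::euclidean_space \<Rightarrow> 'a"
  assumes \<nu>: "prob_space \<nu>" "sets \<nu> = sets borel"
    and F: "(\<lambda>(p, x). F p x) \<in> borel_measurable borel" and N: "N \<in> sets borel"
    and AE: "AE x in \<nu>. AE p in lborel. F p x \<notin> N"
  shows "AE p in lborel. AE x in \<nu>. F p x \<notin> N"
proof -
  interpret prob_space \<nu> by fact
  interpret pair_sigma_finite lborel \<nu> ..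
  have "sets (lborel \<Otimes>\<^sub>M \<nu>) = sets (borel :: ('p \<times> 'a) measure)"
    unfolding borel_prod[symmetric] by (intro sets_pair_measure_cong) (auto simp: \<nu>)
  then have "(\<lambda>(p, x). F p x) \<in> borel_measurable (lborel \<Otimes>\<^sub>M \<nu>)"
    using F measurable_cong_sets by blast
  from measurable_sets[OF this, of "- N"] N
  have "{z \<in> space (lborel \<Otimes>\<^sub>M \<nu>). F (fst z) (snd z) \<notin> N} \<in> sets (lborel \<Otimes>\<^sub>M \<nu>)"
    by (auto simp: case_prod_beta vimage_def Int_def conj_commute)
  from AE_commute[OF this] AE show ?thesis by simp
qed

text \<open>The disjunction serves two uses: for the random homeomorphism the first parameter moves
  the image point along an orbit, for its inverse the second one does.\<close>

lemma AE_lborel_prodI: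
  fixes P :: "'a::euclidean_space \<times> 'b::euclidean_space \<Rightarrow> bool"
  assumes P: "{p. P p} \<in> sets borel"
    and AE: "(AE x in lborel. AE y in lborel. P (x, y)) \<or> (AE y in lborel. AE x in lborel. P (x, y))"
  shows "AE p in lborel. P p"
proof -
  have m: "{p \<in> space (lborel \<Otimes>\<^sub>M lborel). P p} \<in> sets (lborel \<Otimes>\<^sub>M lborel)"
    unfolding lborel_prod using P by simp
  then have "AE x in lborel. AE y in lborel. P (x, y)"
    using AE lborel_pair.AE_commute[of "\<lambda>x y. P (x, y)"] by auto
  from lborel_pair.AE_pair_measure[OF m this] show ?thesis by (simp only: lborel_prod)
qed

lemma homeomorphism_image_eq_vimage:
  assumes "homeomorphism S T f f'" "C \<subseteq> S"
  shows "f ` C = {y \<in> T. f' y \<in> C}"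
proof (intro equalityI subsetI)
  fix y assume "y \<in> {y \<in> T. f' y \<in> C}"
  then have "f' y \<in> C" "y = f (f' y)" using assms(1) by (auto simp: homeomorphism_def)
  then show "y \<in> f ` C" by blast
qed (use assms in \<open>auto simp: homeomorphism_def\<close>)

section \<open>Almost sure singularity of all two-sided translates\<close>

lemma AE_singular_composition:
  fixes s s' :: "real ^ 'n \<Rightarrow> real ^ 'n"
  assumes s: "s \<in> Homeo unit_cube" "s' \<in> Homeo unit_cube" "homeomorphism unit_cube unit_cube s s'"
    and A: "A \<in> null_sets lborel" "{y \<in> unit_cube. s' y \<notin> A} \<in> null_sets lborel"
    and g: "g \<in> Homeo unit_cube" and h: "h \<in> Homeo unit_cube"
  shows "AE p in lborel. singular_homeo (compose unit_cube g
    (compose unit_cube (restrict (\<lambda>x. flow (fst p) (s (flow (- snd p) x))) unit_cube) h))"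
proof -
  obtain g' where g': "g' \<in> Homeo unit_cube" "homeomorphism unit_cube unit_cube g g'"
    using g by (rule Homeo_inverse)
  have [measurable]: "s \<in> borel_measurable borel" "s' \<in> borel_measurable borel"
    "g \<in> borel_measurable borel" "h \<in> borel_measurable borel"
    using s g h by (auto intro: Homeo_borel_measurable)
  interpret \<nu>: prob_space "law h" by (rule law_properties(1)[OF h])
  interpret \<eta>: prob_space "law g'" by (rule law_properties(1)[OF g'(1)])
  obtain N1 where N1: "N1 \<in> null_sets lborel"
    "\<And>B. B \<in> null_sets lborel \<Longrightarrow> B - N1 \<in> null_sets (law h)"
    using null_set_carrying_singular_part[OF \<nu>.finite_measure_axioms, of lborel] by auto
  obtain N2 where N2: "N2 \<in> null_sets lborel"
    "\<And>B. B \<in> null_sets lborel \<Longrightarrow> B - N2 \<in> null_sets (law g')"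
    using null_set_carrying_singular_part[OF \<eta>.finite_measure_axioms, of lborel] by auto
  have [measurable]: "N1 \<in> sets borel" "N2 \<in> sets borel" "A \<in> sets borel"
    using N1 N2 A by auto
  define F where "F p x = flow (fst p) (s (flow (- snd p) x))" for p :: "(real ^ 'n) \<times> (real ^ 'n)" and x
  \<comment> \<open>\<open>F' p\<close> is the inverse of \<open>F p\<close> on the cube, so the two
    parameters exchange their roles.\<close>
  define F' where "F' p y = flow (snd p) (s' (flow (- fst p) y))" for p :: "(real ^ 'n) \<times> (real ^ 'n)" and y
  have [measurable]: "(\<lambda>z. F (f z) (k z)) \<in> borel_measurable M" "(\<lambda>z. F' (f z) (k z)) \<in> borel_measurable M"
    if f: "f \<in> borel_measurable M" and [measurable]: "k \<in> borel_measurable M"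
    for M :: "'b measure" and f :: "'b \<Rightarrow> (real ^ 'n) \<times> (real ^ 'n)" and k
  proof -
    have [measurable]: "(\<lambda>z. fst (f z)) \<in> borel_measurable M" "(\<lambda>z. snd (f z)) \<in> borel_measurable M"
      by (intro borel_measurable_continuous_on[OF _ f] continuous_intros)+
    show "(\<lambda>z. F (f z) (k z)) \<in> borel_measurable M" "(\<lambda>z. F' (f z) (k z)) \<in> borel_measurable M"
      unfolding F_def F'_def by measurable
  qed
  have [measurable]: "(fst :: ((real ^ 'n) \<times> (real ^ 'n)) \<times> (real ^ 'n) \<Rightarrow> _) \<in> borel_measurable borel"
    "(snd :: ((real ^ 'n) \<times> (real ^ 'n)) \<times> (real ^ 'n) \<Rightarrow> _) \<in> borel_measurable borel"
    by (intro borel_measurable_continuous_onI continuous_intros)+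
  have FF': "(\<lambda>(p, x). F p x) \<in> borel_measurable borel" "(\<lambda>(p, x). F' p x) \<in> borel_measurable borel"
    unfolding case_prod_beta by measurable
  \<comment> \<open>For fixed \<open>u\<close> the points \<open>F (t, u) x\<close> run through the
    orbit of one interior point, so they meet \<open>N2\<close> only for a null set of
    \<open>t\<close>.\<close>
  have ae1: "AE p in lborel. AE x in law h. F p x \<notin> N2"
  proof (rule AE_swap_notin)
    show "AE x in law h. AE p in lborel. F p x \<notin> N2"
      using law_properties(3)[OF h]
    proof eventually_elim
      fix x :: "real ^ 'n" assume x: "x \<in> box 0 1"
      show "AE p in lborel. F p x \<notin> N2"
      proof (rule AE_lborel_prodI)
        have "AE t in lborel. F (t, u) x \<notin> N2" for u
          using AE_not_in[OF null_sets_flow_orbit[OF Homeo_unit_cube_box[OF s(1) flow_in_box[OF x]] N2(1)]]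
          by (simp add: F_def)
        then show "(AE t in lborel. AE u in lborel. F (t, u) x \<notin> N2) \<or>
          (AE u in lborel. AE t in lborel. F (t, u) x \<notin> N2)" by simp
      qed measurable
    qed
  qed (auto simp: \<nu>.prob_space_axioms intro: FF')
  \<comment> \<open>In the inverse the outer flow has parameter \<open>u\<close>, so here
    \<open>t\<close> is fixed and \<open>u\<close> varies.\<close>
  have ae2: "AE p in lborel. AE y in law g'. F' p y \<notin> N1"
  proof (rule AE_swap_notin)
    show "AE y in law g'. AE p in lborel. F' p y \<notin> N1"
      using law_properties(3)[OF g'(1)]
    proof eventually_elim
      fix y :: "real ^ 'n" assume y: "y \<in> box 0 1"
      show "AE p in lborel. F' p y \<notin> N1"
      proof (rule AE_lborel_prodI)
        have "AE u in lborel. F' (t, u) y \<notin> N1" for t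
          using AE_not_in[OF null_sets_flow_orbit[OF Homeo_unit_cube_box[OF s(2) flow_in_box[OF y]] N1(1)]]
          by (simp add: F'_def)
        then show "(AE t in lborel. AE u in lborel. F' (t, u) y \<notin> N1) \<or>
          (AE u in lborel. AE t in lborel. F' (t, u) y \<notin> N1)" by simp
      qed measurable
    qed
  qed (auto simp: \<eta>.prob_space_axioms intro: FF')
  from ae1 ae2 show ?thesis
  proof eventually_elim
    fix p assume p1: "AE x in law h. F p x \<notin> N2" and p2: "AE y in law g'. F' p y \<notin> N1"
    obtain t u where p: "p = (t, u)" by (cases p)
    have F: "homeomorphism unit_cube unit_cube (F p) (F' p)"
      using homeomorphism_compose[OF homeomorphism_compose[OF homeomorphism_symD[OF homeomorphism_flow] s(3)]
          homeomorphism_flow, of t u]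
      by (simp add: F_def[abs_def] F'_def[abs_def] p o_def)
    let ?F = "restrict (F p) unit_cube"
    let ?k = "compose unit_cube g (compose unit_cube ?F h)"
    have k: "?k \<in> Homeo unit_cube" using restrict_in_Homeo[OF F] g h by (intro Homeo_compose)
    then obtain k' where k': "k' \<in> Homeo unit_cube" "homeomorphism unit_cube unit_cube ?k k'"
      by (rule Homeo_inverse)
    have [measurable]: "k' \<in> borel_measurable borel" using k'(1) by (intro Homeo_borel_measurable) auto
    \<comment> \<open>A point of \<open>E\<close> is either in \<open>N1\<close>, in which case
      \<open>p2\<close> makes its image negligible, or it is moved off \<open>A\<close> by the inner
      flow, to where \<open>s\<close> has null image. Points landing in \<open>N2\<close> are
      removed because \<eta> may charge null sets there.\<close>
    define E where "E = {x \<in> unit_cube. (x \<in> N1 \<or> flow (- u) x \<notin> A) \<and> F p x \<notin> N2}"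
    have [measurable]: "E \<in> sets borel" unfolding E_def by measurable
    define C where "C = {x \<in> unit_cube. h x \<in> E}"
    have C: "C \<in> sets borel" "C \<subseteq> unit_cube" unfolding C_def by (measurable, auto)
    \<comment> \<open>Off \<open>N1\<close> the measure \<nu> does not charge the Lebesgue null
      preimage of \<open>A\<close> under the inner flow; \<open>p1\<close> deals with
      \<open>N2\<close>.\<close>
    have "AE x in law h. x \<in> E"
      using p1 law_properties(3)[OF h] AE_not_in[OF N1(2)[OF null_sets_flow_vimage[OF A(1), of "- u"]]]
      by eventually_elim (use box_subset_cbox in \<open>auto simp: E_def\<close>)
    then have "AE x in lborel. x \<in> unit_cube \<longrightarrow> h x \<in> E" by (rule law_properties(2)[OF h])
    then have "emeasure lborel C = emeasure lborel (unit_cube :: (real ^ 'n) set)"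
      using C(1) by (intro emeasure_eq_AE) (auto simp: C_def elim!: eventually_mono)
    moreover have "?k ` C \<in> null_sets lborel"
    proof -
      have "?k ` C = {y \<in> unit_cube. k' y \<in> C}"
        using k'(2) C(2) by (rule homeomorphism_image_eq_vimage)
      moreover have "{y \<in> unit_cube. k' y \<in> C} \<in> sets borel" using C(1) by measurable
      ultimately have "?k ` C \<in> sets borel" by simp
      \<comment> \<open>This is the image under \<open>flow t\<close> of the null set onto which
        \<open>s\<close> maps the complement of \<open>A\<close>. It is Lebesgue null, so outside
        \<open>N2\<close> it is also \<eta>-null.\<close>
      let ?W = "{y \<in> unit_cube. flow (- t) y \<in> {y \<in> unit_cube. s' y \<notin> A}}"
      have "AE y in law g'. y \<notin> ?W - N2" by (rule AE_not_in[OF N2(2)[OF null_sets_flow_vimage[OF A(2)]]])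
      with p2 have "AE y in law g'. F' p y \<notin> N1 \<and> y \<notin> ?W - N2" by eventually_elim simp
      then have "AE y in lborel. y \<in> unit_cube \<longrightarrow> F' p (g' y) \<notin> N1 \<and> g' y \<notin> ?W - N2"
        by (rule law_properties(2)[OF g'(1)])
      then have "AE y in lborel. y \<notin> ?k ` C"
      proof eventually_elim
        fix y assume y: "y \<in> unit_cube \<longrightarrow> F' p (g' y) \<notin> N1 \<and> g' y \<notin> ?W - N2"
        show "y \<notin> ?k ` C"
        proof
          assume "y \<in> ?k ` C"
          then obtain x where x: "x \<in> unit_cube" "h x \<in> E" "y = ?k x" by (auto simp: C_def)
          let ?e = "h x"
          have e: "?e \<in> unit_cube" "F p ?e \<in> unit_cube"
            using Homeo_simps(3)[OF h x(1)] F by (auto simp: homeomorphism_def)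
          have "y = g (F p ?e)" using x e by (simp add: compose_def)
          then have gy: "g' y = F p ?e" and yc: "y \<in> unit_cube"
            using g'(2) e by (auto simp: homeomorphism_def)
          have "F' p (F p ?e) = ?e" using F e(1) by (auto simp: homeomorphism_def)
          \<comment> \<open>Membership in \<open>E\<close> now leaves only the alternative avoiding
            \<open>A\<close>, which forces \<open>F p ?e\<close> into \<open>?W - N2\<close>, a
            contradiction.\<close>
          then have "?e \<notin> N1" using y yc gy by simp
          then have nA: "flow (- u) ?e \<notin> A" "F p ?e \<notin> N2" using x(2) by (auto simp: E_def)
          have c: "flow (- u) ?e \<in> unit_cube" "s (flow (- u) ?e) \<in> unit_cube"
            using flow_in_cube[OF e(1)] Homeo_simps(3)[OF s(1)] by auto
          have "flow (- t) (F p ?e) = s (flow (- u) ?e)"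
            using flow_minus[OF c(2)] by (simp add: F_def p)
          moreover have "s' (s (flow (- u) ?e)) = flow (- u) ?e"
            using s(3) c(1) by (auto simp: homeomorphism_def)
          ultimately have "F p ?e \<in> ?W - N2" using c e nA by simp
          then show False using y yc gy by simp
        qed
      qed
      then show ?thesis using \<open>?k ` C \<in> sets borel\<close> by (subst AE_iff_null_sets) auto
    qed
    ultimately have "singular_homeo ?k"
      unfolding singular_homeo_def using k C emeasure_unit_cube by metis
    then show "singular_homeo (compose unit_cube g
      (compose unit_cube (restrict (\<lambda>x. flow (fst p) (s (flow (- snd p) x))) unit_cube) h))"
      by (simp add: F_def[abs_def])
  qed
qed

theorem theorem5p7:
  shows "prevalent (homeo_group (unit_cube :: (real ^ 'n) set)) (homeo_topology unit_cube)
           {f. singular_homeo f}"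
proof -
  obtain s s' :: "real ^ 'n \<Rightarrow> real ^ 'n" and A where
    s: "s \<in> Homeo unit_cube" "s' \<in> Homeo unit_cube" "homeomorphism unit_cube unit_cube s s'"
    and A: "A \<in> null_sets lborel" "{y \<in> unit_cube. s' y \<notin> A} \<in> null_sets lborel"
    by (rule singular_Homeo_exists)
  let ?\<Phi> = "\<lambda>p :: (real ^ 'n) \<times> (real ^ 'n). restrict (\<lambda>x. flow (fst p) (s (flow (- snd p) x))) unit_cube"
  let ?T = "unit_cube \<times> unit_cube :: ((real ^ 'n) \<times> (real ^ 'n)) set"
  \<comment> \<open>Singularity holds for Lebesgue almost all parameters; restriction to a box of
    volume 1 turns Lebesgue measure into a probability measure.\<close>
  let ?\<tau> = "uniform_measure lborel ?T"
  have cpt: "compact (unit_cube :: (real ^ 'n) set)" by simp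
  have \<Phi>: "?\<Phi> p \<in> Homeo unit_cube" for p
    using homeomorphism_compose[OF homeomorphism_compose[OF homeomorphism_flow s(3)] homeomorphism_flow,
        of "fst p" "- snd p"]
    by (intro restrict_in_Homeo) (simp add: o_def)
  have "continuous_on (UNIV \<times> unit_cube) (\<lambda>(p, x). ?\<Phi> p x)"
  proof -
    have s_in: "s x \<in> unit_cube" if "x \<in> unit_cube" for x
      using s(1) that by (rule Homeo_simps(3))
    have "continuous_on (UNIV \<times> unit_cube) (\<lambda>z. s (flow (- snd (fst z)) (snd z)))"
      by (intro continuous_on_compose2[OF Homeo_simps(1)[OF s(1)]] continuous_on_flow continuous_intros)
         (auto intro: flow_in_cube)
    then have "continuous_on (UNIV \<times> unit_cube) (\<lambda>z. flow (fst (fst z)) (s (flow (- snd (fst z)) (snd z))))"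
      by (intro continuous_on_flow continuous_intros) (auto intro!: flow_in_cube s_in)
    then show ?thesis by (rule continuous_on_eq) auto
  qed
  then have meas: "?\<Phi> \<in> borel \<rightarrow>\<^sub>M borel_sigma (homeo_topology unit_cube)"
    using cpt unit_cube_nonempty \<Phi> by (intro measurable_homeo_family)
  have "emeasure lborel ?T = 1"
    unfolding lborel_prod[symmetric]
    by (subst lborel.emeasure_pair_measure_Times) (auto simp: emeasure_unit_cube)
  then have "prob_space ?\<tau>" by (intro prob_space_uniform_measure) auto
  then show ?thesis
  proof (rule prevalent_homeo_groupI[OF cpt unit_cube_nonempty singular_homeo_borel])
    show "?\<Phi> \<in> ?\<tau> \<rightarrow>\<^sub>M borel_sigma (homeo_topology unit_cube)" using meas by simp
    fix g h assume "g \<in> Homeo (unit_cube :: (real ^ 'n) set)" "h \<in> Homeo (unit_cube :: (real ^ 'n) set)"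
    from AE_singular_composition[OF s A this]
    show "AE p in ?\<tau>. compose unit_cube g (compose unit_cube (?\<Phi> p) h) \<in> {f. singular_homeo f}"
      by (intro AE_uniform_measureI)
         (auto elim!: eventually_mono intro!: borel_closed closed_Times)
  qed
qed

end
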